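(* Let $g\in L^2(\mathbb{R})$ and $\Lambda\subset\mathbb{R}^2$. If $G(g,\Lambda)$ is uniformly minimal in $L^2(\mathbb{R})$, then \[ D^+(\Lambda):=\limsup_{R\to\infty}\frac{\sup_{(a,b)\in\mathbb{R}^2}|\Lambda\cap Q_{(a,b)}(R)|}{(2R)^2}\le 1. \]
   Context: For $g\in L^2(\mathbb{R})$ and $(a,b)\in\mathbb{R}^2$ put $g_{ab}(t)=e^{2\pi i b t}g(t-a)$. The Gabor system is $G(g,\Lambda)=\{g_{\lambda\mu}\}_{(\lambda,\mu)\in\Lambda}$. $Q_{(a,b)}(R)=\{(x,y):|x-a|\le R,\ |y-b|\le R\}$, and $|\Lambda\cap S|$ is the number of points of $\Lambda$ in $S$. A system $\{f_n\}$ in a Hilbert space is uniformly minimal if there is $\delta>0$ such that $\operatorname{dist}(f_n,\overline{\operatorname{span}}\{f_k\}_{k\ne n})>\delta$ for all $n$. *)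

theory Defs
  imports "HOL-Analysis.Analysis" "HOL-Library.Liminf_Limsup"
begin

definition in_L2 :: "(real \<Rightarrow> complex) \<Rightarrow> bool" where
  "in_L2 f \<longleftrightarrow> f \<in> borel_measurable lborel \<and> integrable lborel (\<lambda>t. (cmod (f t))\<^sup>2)"

definition L2_norm :: "(real \<Rightarrow> complex) \<Rightarrow> real" where
  "L2_norm f = sqrt (integral\<^sup>L lborel (\<lambda>t. (cmod (f t))\<^sup>2))"

definition tf_shift :: "(real \<Rightarrow> complex) \<Rightarrow> real \<times> real \<Rightarrow> real \<Rightarrow> complex" where
  "tf_shift g p = (\<lambda>t. cis (2 * pi * snd p * t) * g (t - fst p))"

definition lin_span :: "('i \<Rightarrow> real \<Rightarrow> complex) \<Rightarrow> 'i set \<Rightarrow> (real \<Rightarrow> complex) set" where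
  "lin_span f I = {h. \<exists>F c. finite F \<and> F \<subseteq> I \<and> h = (\<lambda>t. \<Sum>k\<in>F. c k * f k t)}"

text \<open>L2-distance from a function to the closed linear span of a family (the distance
  to the closure of a set equals the distance to the set).\<close>
definition L2_dist_span :: "(real \<Rightarrow> complex) \<Rightarrow> ('i \<Rightarrow> real \<Rightarrow> complex) \<Rightarrow> 'i set \<Rightarrow> real" where
  "L2_dist_span h f I = Inf ((\<lambda>u. L2_norm (\<lambda>t. h t - u t)) ` lin_span f I)"

definition uniformly_minimal :: "('i \<Rightarrow> real \<Rightarrow> complex) \<Rightarrow> 'i set \<Rightarrow> bool" where
  "uniformly_minimal f I \<longleftrightarrow> (\<exists>\<delta>>0. \<forall>n\<in>I. L2_dist_span (f n) f (I - {n}) > \<delta>)"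

definition square :: "real \<times> real \<Rightarrow> real \<Rightarrow> (real \<times> real) set" where
  "square c R = {(x, y). \<bar>x - fst c\<bar> \<le> R \<and> \<bar>y - snd c\<bar> \<le> R}"

definition num_pts :: "'a set \<Rightarrow> 'a set \<Rightarrow> ereal" where
  "num_pts \<Lambda> S = (if finite (\<Lambda> \<inter> S) then ereal (real (card (\<Lambda> \<inter> S))) else \<infinity>)"

definition upper_density :: "(real \<times> real) set \<Rightarrow> ereal" where
  "upper_density \<Lambda> = Limsup at_top
     (\<lambda>R::real. (SUP c. num_pts \<Lambda> (square c R)) / ereal ((2 * R)\<^sup>2))"

end

theory Submission
  imports Defs
begin

text \<open>
  The Gabor system is compared with the lattice system generated by the indicator function of
  the unit interval, in the manner of Ramanathan and Steger. The latter spans \<open>L\<^sup>2\<close> densely, and by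
  compactness of the unit square every time-frequency shift of \<open>g\<close> lies within \<open>\<epsilon>\<close> of
  the span of the lattice elements at distance at most \<open>r\<close> from it, with \<open>r\<close> independent of the
  shift. For the \<open>N\<close> points of \<open>\<Lambda>\<close> in a square of radius \<open>R\<close> take the product of the orthogonal
  projections onto the span of the corresponding shifts of \<open>g\<close> and onto the span of the lattice
  elements in the square of radius \<open>R + r\<close>. Uniform minimality bounds the norms of the dual basis of
  the shifts by \<open>1 / \<delta>\<close>, so the trace of this product is at least \<open>N (1 - \<epsilon> / \<delta>)\<close>; it is at
  most the dimension of the second space, hence at most \<open>(2 (R + r) + 1)\<^sup>2\<close>.
\<close>

subsection \<open>Vectors close to a subspace\<close>

text \<open>The sum is the orthogonal projection of \<open>x\<close> in an orthogonal basis.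
  \<open>C\<close> may contain 0; its term vanishes because division by zero yields 0.\<close>

lemma orthogonal_expansion_residual:
  fixes x :: "'a::real_inner"
  assumes C: "finite C" "pairwise orthogonal C" and y: "y \<in> span C"
  shows "(x - (\<Sum>c\<in>C. (x \<bullet> c / (c \<bullet> c)) *\<^sub>R c)) \<bullet> y = 0"
proof -
  define p where "p = (\<Sum>c\<in>C. (x \<bullet> c / (c \<bullet> c)) *\<^sub>R c)"
  have base: "orthogonal (x - p) c" if "c \<in> C" for c
  proof -
    have "p \<bullet> c = (\<Sum>b\<in>C. (x \<bullet> b / (b \<bullet> b)) * (b \<bullet> c))"
      by (simp add: p_def inner_sum_left)
    also have "\<dots> = (\<Sum>b\<in>C. if b = c then x \<bullet> c else 0)"
      using C(2) that by (intro sum.cong) (auto simp: pairwise_def orthogonal_def)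
    also have "\<dots> = x \<bullet> c"
      using C(1) that by simp
    finally show ?thesis
      by (simp add: orthogonal_def inner_diff_left)
  qed
  then have "orthogonal (x - p) y"
    using y orthogonal_to_span[of y C "x - p"] by auto
  then show ?thesis
    by (simp add: orthogonal_def p_def)
qed

lemma orthogonal_projection_exists:
  fixes x :: "'a::real_inner"
  assumes "finite S"
  shows "\<exists>p\<in>span S. \<forall>y\<in>span S. (x - p) \<bullet> y = 0"
proof -
  obtain C where C: "finite C" "span C = span S" "pairwise orthogonal C"
    using basis_orthogonal[OF assms] by blast
  define p where "p = (\<Sum>c\<in>C. (x \<bullet> c / (c \<bullet> c)) *\<^sub>R c)"
  have "p \<in> span S"
    unfolding p_def C(2)[symmetric] by (intro span_sum span_scale span_base)
  moreover have "(x - p) \<bullet> y = 0" if "y \<in> span S" for y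
    using orthogonal_expansion_residual[OF C(1,3)] that C(2) by (simp add: p_def)
  ultimately show ?thesis by blast
qed

text \<open>The residual of \<open>v i\<close> after projection onto the span of the other vectors
  has norm at least \<open>d\<close> and is orthogonal to those vectors. Dividing it by its squared
  norm gives \<open>h i\<close>, of norm at most \<open>1 / d\<close>.\<close>

lemma dual_basis_exists:
  fixes v :: "'i \<Rightarrow> 'a::real_inner"
  assumes I: "finite I" and d: "d > 0"
    and sep: "\<And>i u. i \<in> I \<Longrightarrow> u \<in> span (v ` (I - {i})) \<Longrightarrow> d \<le> norm (v i - u)"
  shows "\<exists>h. \<forall>i\<in>I. h i \<in> span (v ` I) \<and> norm (h i) \<le> 1 / d
             \<and> (\<forall>j\<in>I. v j \<bullet> h i = (if j = i then 1 else 0))"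
proof -
  have "\<exists>w. w \<in> span (v ` I) \<and> norm w \<le> 1 / d \<and> (\<forall>j\<in>I. v j \<bullet> w = (if j = i then 1 else 0))"
    if i: "i \<in> I" for i
  proof -
    obtain p where p: "p \<in> span (v ` (I - {i}))"
      and orth: "\<And>y. y \<in> span (v ` (I - {i})) \<Longrightarrow> (v i - p) \<bullet> y = 0"
      using orthogonal_projection_exists[of "v ` (I - {i})" "v i"] I by auto
    define r where "r = v i - p"
    have r: "d \<le> norm r"
      using sep[OF i p] by (simp add: r_def)
    have r0: "r \<bullet> r > 0"
      using r d by (smt (verit) inner_gt_zero_iff norm_zero)
    have vi: "v i \<bullet> r = r \<bullet> r"
      using orth[OF p] by (simp add: r_def inner_diff_left inner_diff_right inner_commute)
    have vj: "v j \<bullet> r = 0" if "j \<in> I" "j \<noteq> i" for j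
      using orth[of "v j"] that by (auto simp: r_def inner_commute intro!: span_base)
    have "p \<in> span (v ` I)"
      using p span_mono[of "v ` (I - {i})" "v ` I"] by blast
    then have "r \<in> span (v ` I)"
      unfolding r_def using i by (intro span_diff) (auto intro: span_base)
    moreover have "norm ((1 / (r \<bullet> r)) *\<^sub>R r) \<le> 1 / d"
      using r d r0 by (auto simp: power2_norm_eq_inner[symmetric] power2_eq_square divide_simps)
    ultimately show ?thesis
      using vi vj r0 by (intro exI[of _ "(1 / (r \<bullet> r)) *\<^sub>R r"]) (auto intro: span_scale)
  qed
  then show ?thesis by (intro bchoice ballI) blast
qed

text \<open>
  The two bounds on the trace of the composition of the orthogonal projections onto
  \<^term>\<open>span B\<close> and \<^term>\<open>span (v ` I)\<close>: its trace is at most the dimension of the former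
  space, and computing it in the basis \<^term>\<open>v\<close> and its dual basis gives the lower bound.
\<close>
lemma card_le_of_near_subspace:
  fixes v :: "'i \<Rightarrow> 'a::real_inner"
  assumes I: "finite I" and B: "finite B" and d: "d > 0"
    and sep: "\<And>i u. i \<in> I \<Longrightarrow> u \<in> span (v ` (I - {i})) \<Longrightarrow> d \<le> norm (v i - u)"
    and near: "\<And>i. i \<in> I \<Longrightarrow> \<exists>w\<in>span B. norm (v i - w) \<le> e"
  shows "real (card I) * (1 - e / d) \<le> real (card B)"
proof -
  obtain h where dual: "\<forall>i\<in>I. h i \<in> span (v ` I) \<and> norm (h i) \<le> 1 / d
      \<and> (\<forall>j\<in>I. v j \<bullet> h i = (if j = i then 1 else 0))"
    using dual_basis_exists[of I d v] I d sep by auto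
  have h: "\<And>i. i \<in> I \<Longrightarrow> h i \<in> span (v ` I)" "\<And>i. i \<in> I \<Longrightarrow> norm (h i) \<le> 1 / d"
    "\<And>i j. i \<in> I \<Longrightarrow> j \<in> I \<Longrightarrow> v j \<bullet> h i = (if j = i then 1 else 0)"
    using dual by auto
  obtain C where C: "finite C" "card C \<le> card B" "span C = span B" "pairwise orthogonal C"
    using basis_orthogonal[OF B] by blast
  define P where "P x = (\<Sum>c\<in>C. (x \<bullet> c / (c \<bullet> c)) *\<^sub>R c)" for x
  \<comment> \<open>Since the \<open>h i\<close> lie in the span of the \<open>v i\<close> and are
    dual to them, \<open>T\<close> is the orthogonal projection onto that span. Both
    \<open>fix_v\<close> and \<open>T_le\<close> express parts of this.\<close>
  define T where "T x = (\<Sum>i\<in>I. (x \<bullet> h i) *\<^sub>R v i)" for x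
  have Pspan: "P x \<in> span C" for x
    unfolding P_def by (intro span_sum span_scale span_base)
  have Porth: "(x - P x) \<bullet> y = 0" if "y \<in> span C" for x y
    unfolding P_def using orthogonal_expansion_residual[OF C(1,4) that] .
  \<comment> \<open>By Pythagoras \<open>P (v i)\<close> is at least as close to \<open>v i\<close>
    as any other element of the span, in particular as \<open>w\<close>.\<close>
  have Pnear: "norm (v i - P (v i)) \<le> e" if i: "i \<in> I" for i
  proof -
    obtain w where w: "w \<in> span C" "norm (v i - w) \<le> e"
      using near[OF i] C(3) by blast
    have "orthogonal (v i - P (v i)) (P (v i) - w)"
      unfolding orthogonal_def by (intro Porth span_diff Pspan w)
    from norm_add_Pythagorean[OF this]
    have "(norm (v i - P (v i)))\<^sup>2 \<le> (norm (v i - w))\<^sup>2"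
      by simp
    then show ?thesis
      using w(2) power2_le_imp_le[OF _ norm_ge_zero] by (meson order_trans)
  qed
  \<comment> \<open>By duality \<open>v i \<bullet> h i\<close> is 1, and replacing
    \<open>v i\<close> by its projection costs at most \<open>e * (1 / d)\<close>.\<close>
  have low: "1 - e / d \<le> P (v i) \<bullet> h i" if i: "i \<in> I" for i
  proof -
    have "(v i - P (v i)) \<bullet> h i \<le> norm (v i - P (v i)) * norm (h i)"
      by (rule norm_cauchy_schwarz)
    also have "\<dots> \<le> e * (1 / d)"
      using Pnear[OF i] h(2)[OF i] order_trans[OF norm_ge_zero Pnear[OF i]]
      by (intro mult_mono) auto
    finally show ?thesis
      using h(3)[OF i i] by (simp add: inner_diff_left)
  qed
  have fix_v: "T y = y" if "y \<in> span (v ` I)" for y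
  proof -
    have "subspace {y. T y = y}"
      unfolding subspace_def T_def
      by (auto simp: inner_add_left scaleR_add_left sum.distrib)
        (simp flip: scaleR_scaleR scaleR_sum_right)
    moreover have "T (v j) = v j" if "j \<in> I" for j
    proof -
      have "T (v j) = (\<Sum>i\<in>I. if i = j then v j else 0)"
        unfolding T_def using h(3) that by (intro sum.cong) auto
      then show ?thesis using I that by simp
    qed
    ultimately have "span (v ` I) \<subseteq> {y. T y = y}"
      by (intro span_minimal) auto
    then show ?thesis using that by auto
  qed
  have T_le: "T x \<bullet> x \<le> x \<bullet> x" for x
  proof -
    obtain p where p: "p \<in> span (v ` I)"
      and orth: "\<And>y. y \<in> span (v ` I) \<Longrightarrow> (x - p) \<bullet> y = 0"
      using orthogonal_projection_exists[of "v ` I" x] I by auto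
    have "T x = T p"
      unfolding T_def using orth h(1) by (intro sum.cong) (auto simp: inner_diff_left)
    then have Tx: "T x = p"
      using fix_v[OF p] by simp
    have "x \<bullet> x = p \<bullet> p + (x - p) \<bullet> (x - p)"
      using orth[OF p] by (simp add: inner_diff_left inner_diff_right inner_commute)
    then have "p \<bullet> p \<le> x \<bullet> x"
      by simp
    then show ?thesis
      using orth[OF p] unfolding Tx by (simp add: inner_diff_left inner_commute[of p x])
  qed
  have "real (card I) * (1 - e / d) = (\<Sum>i\<in>I. 1 - e / d)"
    by simp
  also have "\<dots> \<le> (\<Sum>i\<in>I. P (v i) \<bullet> h i)"
    by (intro sum_mono low)
  \<comment> \<open>Expanding \<open>P\<close> in the basis \<open>C\<close> and exchanging the sums
    moves the trace computation from the \<open>v i\<close> to \<open>C\<close>, where each term is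
    at most 1.\<close>
  also have "\<dots> = (\<Sum>i\<in>I. \<Sum>c\<in>C. (v i \<bullet> c) * (c \<bullet> h i) / (c \<bullet> c))"
    by (simp add: P_def inner_sum_left)
  also have "\<dots> = (\<Sum>c\<in>C. \<Sum>i\<in>I. (v i \<bullet> c) * (c \<bullet> h i) / (c \<bullet> c))"
    by (rule sum.swap)
  also have "\<dots> = (\<Sum>c\<in>C. (T c \<bullet> c) / (c \<bullet> c))"
    by (simp add: T_def inner_sum_left sum_divide_distrib mult.commute)
  also have "\<dots> \<le> (\<Sum>c\<in>C. 1)"
    using T_le by (intro sum_mono) (simp add: divide_le_eq_1)
  also have "\<dots> \<le> real (card B)"
    using C(2) by simp
  finally show ?thesis .
qed

subsection \<open>The space of square integrable functions\<close>

lemma in_L2D: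
  assumes "in_L2 f"
  shows "f \<in> borel_measurable borel" "integrable lborel (\<lambda>t. (cmod (f t))\<^sup>2)"
  using assms by (auto simp: in_L2_def)

lemma in_L2_zero: "in_L2 (\<lambda>t. 0)"
  by (simp add: in_L2_def)

lemma in_L2_dominated:
  assumes "f \<in> borel_measurable borel" "in_L2 g" "AE t in lborel. cmod (f t) \<le> cmod (g t)"
  shows "in_L2 f"
proof -
  have "integrable lborel (\<lambda>t. (cmod (f t))\<^sup>2)"
    using assms(1,3) by (intro Bochner_Integration.integrable_bound[OF in_L2D(2)[OF assms(2)]])
      (auto intro!: power_mono)
  then show ?thesis
    using assms(1) by (simp add: in_L2_def)
qed

lemma in_L2_mult:
  assumes "in_L2 f"
  shows "in_L2 (\<lambda>t. z * f t)"
  using in_L2D[OF assms] by (auto simp: in_L2_def norm_mult power_mult_distrib)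

lemma in_L2_add:
  assumes "in_L2 f" "in_L2 g"
  shows "in_L2 (\<lambda>t. f t + g t)"
proof -
  have m: "f \<in> borel_measurable borel" "g \<in> borel_measurable borel"
    using assms in_L2D by auto
  have "integrable lborel (\<lambda>t. 2 * (cmod (f t))\<^sup>2 + 2 * (cmod (g t))\<^sup>2)"
    using assms in_L2D by auto
  then have "integrable lborel (\<lambda>t. (cmod (f t + g t))\<^sup>2)"
  proof (rule Bochner_Integration.integrable_bound)
    have "(cmod (f t + g t))\<^sup>2 \<le> 2 * (cmod (f t))\<^sup>2 + 2 * (cmod (g t))\<^sup>2" for t
    proof -
      have "(cmod (f t + g t))\<^sup>2 \<le> (cmod (f t) + cmod (g t))\<^sup>2"
        by (intro power_mono norm_triangle_ineq) auto
      also have "\<dots> \<le> 2 * (cmod (f t))\<^sup>2 + 2 * (cmod (g t))\<^sup>2"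
        using sum_squares_ge_zero[of "cmod (f t) - cmod (g t)" 0]
        by (simp add: power2_eq_square algebra_simps)
      finally show ?thesis .
    qed
    then show "AE t in lborel. norm ((cmod (f t + g t))\<^sup>2)
        \<le> norm (2 * (cmod (f t))\<^sup>2 + 2 * (cmod (g t))\<^sup>2)"
      by auto
  qed (use m in measurable)
  then show ?thesis
    using m by (simp add: in_L2_def)
qed

lemma in_L2_minus: "in_L2 f \<Longrightarrow> in_L2 (\<lambda>t. - f t)"
  using in_L2_mult[of f "-1"] by simp

lemma in_L2_diff: "in_L2 f \<Longrightarrow> in_L2 g \<Longrightarrow> in_L2 (\<lambda>t. f t - g t)"
  using in_L2_add[OF _ in_L2_minus, of f g] by simp

lemma in_L2_scaleR: "in_L2 f \<Longrightarrow> in_L2 (\<lambda>t. r *\<^sub>R f t)"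
  using in_L2_mult[of f "of_real r"] by (simp add: scaleR_conv_of_real)

lemma in_L2_sum:
  "(\<And>i. i \<in> I \<Longrightarrow> in_L2 (f i)) \<Longrightarrow> in_L2 (\<lambda>t. \<Sum>i\<in>I. f i t)"
  by (induction I rule: infinite_finite_induct) (auto intro: in_L2_zero in_L2_add)

text \<open>Polarization writes the integrand as a combination of three integrable squared
  moduli.\<close>

lemma integrable_inner_L2:
  assumes "in_L2 f" "in_L2 g"
  shows "integrable lborel (\<lambda>t. f t \<bullet> g t)"
proof -
  have "integrable lborel (\<lambda>t. ((cmod (f t + g t))\<^sup>2 - (cmod (f t))\<^sup>2 - (cmod (g t))\<^sup>2) / 2)"
    using in_L2D(2)[OF in_L2_add[OF assms]] in_L2D(2)[OF assms(1)] in_L2D(2)[OF assms(2)] by auto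
  also have "(\<lambda>t. ((cmod (f t + g t))\<^sup>2 - (cmod (f t))\<^sup>2 - (cmod (g t))\<^sup>2) / 2) = (\<lambda>t. f t \<bullet> g t)"
    by (simp add: power2_norm_eq_inner inner_add_left inner_add_right inner_commute)
  finally show ?thesis .
qed

\<comment> \<open>Passing to classes modulo almost everywhere equality makes the inner product
  definite, so that the abstract results on inner product spaces apply. The relation is partial
  because functions outside \<L>2 have no class.\<close>
quotient_type l2 = "real \<Rightarrow> complex" / partial: "\<lambda>f g. in_L2 f \<and> in_L2 g \<and> (AE t in lborel. f t = g t)"
proof (rule part_equivpI)
  show "\<exists>f. in_L2 f \<and> in_L2 f \<and> (AE t in lborel. f t = f t)"
    using in_L2_zero by auto
qed (auto simp: symp_def transp_def)

instantiation l2 :: real_vector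
begin

lift_definition zero_l2 :: l2 is "\<lambda>t. 0"
  by (auto intro: in_L2_zero)

lift_definition plus_l2 :: "l2 \<Rightarrow> l2 \<Rightarrow> l2" is "\<lambda>f g t. f t + g t"
  by (auto intro: in_L2_add)

lift_definition minus_l2 :: "l2 \<Rightarrow> l2 \<Rightarrow> l2" is "\<lambda>f g t. f t - g t"
  by (auto intro: in_L2_diff)

lift_definition uminus_l2 :: "l2 \<Rightarrow> l2" is "\<lambda>f t. - f t"
  by (auto intro: in_L2_minus)

lift_definition scaleR_l2 :: "real \<Rightarrow> l2 \<Rightarrow> l2" is "\<lambda>r f t. r *\<^sub>R f t"
  by (auto intro: in_L2_scaleR)

instance
proof
  fix x y z :: l2 and r s :: real
  show "x + y + z = x + (y + z)"
    by transfer (simp add: add.assoc in_L2_add)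
  show "x + y = y + x"
    by transfer (simp add: add.commute in_L2_add)
  show "0 + x = x"
    by transfer simp
  show "- x + x = 0"
    by transfer (simp add: in_L2_zero)
  show "x - y = x + - y"
    by transfer (simp add: in_L2_diff)
  show "r *\<^sub>R (x + y) = r *\<^sub>R x + r *\<^sub>R y"
    by transfer (simp add: scaleR_add_right in_L2_scaleR in_L2_add)
  show "(r + s) *\<^sub>R x = r *\<^sub>R x + s *\<^sub>R x"
    by transfer (simp add: scaleR_add_left in_L2_scaleR in_L2_add)
  show "r *\<^sub>R s *\<^sub>R x = (r * s) *\<^sub>R x"
    by transfer (simp add: in_L2_scaleR)
  show "1 *\<^sub>R x = x"
    by transfer simp
qed

end

instantiation l2 :: real_inner
begin

text \<open>On complex numbers \<open>\<bullet>\<close> is the real inner product, so this is the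
  real part of the Hermitian product; it induces the same norm.\<close>

lift_definition inner_l2 :: "l2 \<Rightarrow> l2 \<Rightarrow> real" is "\<lambda>f g. integral\<^sup>L lborel (\<lambda>t. f t \<bullet> g t)"
proof -
  fix f f' g g' :: "real \<Rightarrow> complex"
  assume f: "in_L2 f \<and> in_L2 f' \<and> (AE t in lborel. f t = f' t)"
    and g: "in_L2 g \<and> in_L2 g' \<and> (AE t in lborel. g t = g' t)"
  have "AE t in lborel. f t \<bullet> g t = f' t \<bullet> g' t"
    using f g by auto
  then show "integral\<^sup>L lborel (\<lambda>t. f t \<bullet> g t) = integral\<^sup>L lborel (\<lambda>t. f' t \<bullet> g' t)"
    using f g by (intro integral_cong_AE borel_measurable_inner) (auto dest: in_L2D)
qed

definition norm_l2 :: "l2 \<Rightarrow> real" where "norm_l2 x = sqrt (x \<bullet> x)"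
definition dist_l2 :: "l2 \<Rightarrow> l2 \<Rightarrow> real" where "dist_l2 x y = norm (x - y)"
definition sgn_l2 :: "l2 \<Rightarrow> l2" where "sgn_l2 x = inverse (norm x) *\<^sub>R x"
definition uniformity_l2 :: "(l2 \<times> l2) filter" where
  "uniformity_l2 = (INF e\<in>{0<..}. principal {(x, y). dist x y < e})"
definition open_l2 :: "l2 set \<Rightarrow> bool" where
  "open_l2 U \<longleftrightarrow> (\<forall>x\<in>U. \<forall>\<^sub>F (x', y) in uniformity. x' = x \<longrightarrow> y \<in> U)"

instance
proof
  fix x y z :: l2 and r :: real
  show "dist x y = norm (x - y)"
    by (rule dist_l2_def)
  show "sgn x = x /\<^sub>R norm x"
    by (rule sgn_l2_def)
  show "uniformity = (INF e\<in>{0<..}. principal {(x, y :: l2). dist x y < e})"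
    by (rule uniformity_l2_def)
  show "open U \<longleftrightarrow> (\<forall>x\<in>U. \<forall>\<^sub>F (x', y) in uniformity. x' = x \<longrightarrow> y \<in> U)" for U :: "l2 set"
    by (rule open_l2_def)
  show "x \<bullet> y = y \<bullet> x"
    by transfer (simp add: inner_commute)
  show "(x + y) \<bullet> z = x \<bullet> z + y \<bullet> z"
    by transfer (simp add: inner_add_left integrable_inner_L2)
  show "(r *\<^sub>R x) \<bullet> y = r * (x \<bullet> y)"
    by transfer simp
  show "0 \<le> x \<bullet> x"
    by transfer simp
  show "x \<bullet> x = 0 \<longleftrightarrow> x = 0"
  proof transfer
    fix f :: "real \<Rightarrow> complex"
    assume f: "in_L2 f \<and> in_L2 f \<and> (AE t in lborel. f t = f t)"
    then have "integral\<^sup>L lborel (\<lambda>t. f t \<bullet> f t) = 0 \<longleftrightarrow> (AE t in lborel. f t \<bullet> f t = 0)"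
      by (intro integral_nonneg_eq_0_iff_AE integrable_inner_L2) auto
    then show "integral\<^sup>L lborel (\<lambda>t. f t \<bullet> f t) = 0 \<longleftrightarrow>
        in_L2 f \<and> in_L2 (\<lambda>t. 0) \<and> (AE t in lborel. f t = 0)"
      using f by (simp add: in_L2_zero)
  qed
  show "norm x = sqrt (x \<bullet> x)"
    by (rule norm_l2_def)
qed

end

section \<open>Complex scalars, representatives and dominated convergence\<close>

lift_definition cscale :: "complex \<Rightarrow> l2 \<Rightarrow> l2" is "\<lambda>z f t. z * f t"
  by (auto intro: in_L2_mult)

lemma abs_l2_cases:
  obtains f where "in_L2 f" "x = abs_l2 f"
  using Quotient3_abs_rep[OF Quotient3_l2, of x] Quotient3_rep_reflp[OF Quotient3_l2, of x]
  by (metis (no_types, lifting))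

lemma norm_abs_l2: "in_L2 f \<Longrightarrow> norm (abs_l2 f) = L2_norm f"
  by (simp add: norm_l2_def inner_l2.abs_eq L2_norm_def power2_norm_eq_inner)

lemma abs_l2_add: "in_L2 f \<Longrightarrow> in_L2 g \<Longrightarrow> abs_l2 f + abs_l2 g = abs_l2 (\<lambda>t. f t + g t)"
  by (simp add: plus_l2.abs_eq)

lemma abs_l2_diff: "in_L2 f \<Longrightarrow> in_L2 g \<Longrightarrow> abs_l2 f - abs_l2 g = abs_l2 (\<lambda>t. f t - g t)"
  by (simp add: minus_l2.abs_eq)

lemma abs_l2_cscale: "in_L2 f \<Longrightarrow> cscale z (abs_l2 f) = abs_l2 (\<lambda>t. z * f t)"
  by (simp add: cscale.abs_eq)

lemma abs_l2_zero: "0 = abs_l2 (\<lambda>t. 0)"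
  by (simp add: zero_l2_def)

lemma abs_l2_sum:
  assumes "finite I" "\<And>i. i \<in> I \<Longrightarrow> in_L2 (f i)"
  shows "(\<Sum>i\<in>I. abs_l2 (f i)) = abs_l2 (\<lambda>t. \<Sum>i\<in>I. f i t)"
  using assms by (induction I) (auto simp: abs_l2_add in_L2_sum simp flip: abs_l2_zero)

lemma linear_cscale: "linear (cscale z)"
  by (rule linearI; transfer) (auto simp: algebra_simps intro!: in_L2_add in_L2_mult in_L2_scaleR)

lemma cscale_cscale: "cscale z (cscale w x) = cscale (z * w) x"
  by transfer (auto simp: algebra_simps intro!: in_L2_mult)

text \<open>This reduces complex multiples to real combinations of \<open>x\<close> and
  \<open>cscale \<i> x\<close>, which is how complex spans are expressed as real ones.\<close>

lemma cscale_conv_scaleR: "cscale z x = Re z *\<^sub>R x + Im z *\<^sub>R cscale \<i> x"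
proof (transfer, intro conjI)
  fix z and f :: "real \<Rightarrow> complex"
  assume "in_L2 f \<and> in_L2 f \<and> (AE t in lborel. f t = f t)"
  then show "in_L2 (\<lambda>t. z * f t)" "in_L2 (\<lambda>t. Re z *\<^sub>R f t + Im z *\<^sub>R (\<i> * f t))"
    by (auto intro!: in_L2_add in_L2_mult in_L2_scaleR)
  show "AE t in lborel. z * f t = Re z *\<^sub>R f t + Im z *\<^sub>R (\<i> * f t)"
    by (auto simp: complex_eq_iff algebra_simps)
qed

lemma cscale_one: "cscale 1 x = x"
  using cscale_conv_scaleR[of 1 x] by simp

lemma norm_cscale: "norm (cscale z x) = cmod z * norm x"
proof -
  obtain f where f: "in_L2 f" "x = abs_l2 f"
    by (rule abs_l2_cases)
  show ?thesis
    unfolding f(2) using f(1)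
    by (simp add: abs_l2_cscale norm_abs_l2 in_L2_mult L2_norm_def norm_mult power_mult_distrib
        real_sqrt_mult)
qed

text \<open>Dominated convergence applied to the squared differences, which are bounded by four
  times the squared modulus of \<open>G\<close>. All norm limits of concrete functions below are
  obtained from it.\<close>

lemma tendsto_abs_l2:
  assumes meas: "\<And>n. h n \<in> borel_measurable borel" "f \<in> borel_measurable borel"
    and G: "in_L2 G"
    and lim: "AE t in lborel. (\<lambda>n. h n t) \<longlonglongrightarrow> f t"
    and bound: "\<And>n. AE t in lborel. cmod (h n t) \<le> cmod (G t)"
  shows "in_L2 f" "\<And>n. in_L2 (h n)" "(\<lambda>n. abs_l2 (h n)) \<longlonglongrightarrow> abs_l2 f"
proof -
  show h: "in_L2 (h n)" for n
    using in_L2_dominated[OF meas(1) G bound] .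
  have bdAll: "AE t in lborel. \<forall>n. cmod (h n t) \<le> cmod (G t)"
    using bound by (simp add: AE_all_countable)
  have fbd: "AE t in lborel. cmod (f t) \<le> cmod (G t)"
    using lim bdAll
  proof eventually_elim
    case (elim t)
    show ?case
      using elim(2) by (intro LIMSEQ_le_const2[OF tendsto_norm[OF elim(1)]]) auto
  qed
  show f: "in_L2 f"
    using in_L2_dominated[OF meas(2) G fbd] .
  have "(\<lambda>n. integral\<^sup>L lborel (\<lambda>t. (cmod (h n t - f t))\<^sup>2)) \<longlonglongrightarrow> integral\<^sup>L lborel (\<lambda>t::real. 0::real)"
  proof (rule integral_dominated_convergence[where w = "\<lambda>t. 4 * (cmod (G t))\<^sup>2"])
    show "integrable lborel (\<lambda>t. 4 * (cmod (G t))\<^sup>2)"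
      using in_L2D[OF G] by simp
    show "AE t in lborel. (\<lambda>n. (cmod (h n t - f t))\<^sup>2) \<longlonglongrightarrow> 0"
      using lim
    proof eventually_elim
      case (elim t)
      have "(\<lambda>n. (cmod (h n t - f t))\<^sup>2) \<longlonglongrightarrow> (cmod (f t - f t))\<^sup>2"
        by (intro tendsto_intros elim)
      then show ?case by simp
    qed
    show "AE t in lborel. norm ((cmod (h n t - f t))\<^sup>2) \<le> 4 * (cmod (G t))\<^sup>2" for n
      using bound[of n] fbd
    proof eventually_elim
      case (elim t)
      have "cmod (h n t - f t) \<le> 2 * cmod (G t)"
        using norm_triangle_ineq4[of "h n t" "f t"] elim by simp
      then have "(cmod (h n t - f t))\<^sup>2 \<le> (2 * cmod (G t))\<^sup>2"
        by (intro power_mono) auto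
      then show ?case
        by (simp add: power_mult_distrib)
    qed
  qed (use meas in measurable)
  then have "(\<lambda>n. sqrt (integral\<^sup>L lborel (\<lambda>t. (cmod (h n t - f t))\<^sup>2))) \<longlonglongrightarrow> sqrt 0"
    by (intro tendsto_real_sqrt) simp
  then have "(\<lambda>n. norm (abs_l2 (h n) - abs_l2 f)) \<longlonglongrightarrow> 0"
    using f h by (simp add: abs_l2_diff norm_abs_l2 in_L2_diff L2_norm_def)
  then show "(\<lambda>n. abs_l2 (h n)) \<longlonglongrightarrow> abs_l2 f"
    by (rule LIM_zero_cancel[OF tendsto_norm_zero_cancel])
qed

subsection \<open>Time-frequency shifts\<close>

lemma span_induct_subspace:
  assumes "y \<in> span S" "subspace V" "\<And>s. s \<in> S \<Longrightarrow> s \<in> V"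
  shows "y \<in> V"
  using span_minimal[of S V] assms by blast

lemma linear_image_span_subset:
  assumes "linear f" "y \<in> span S" "\<And>s. s \<in> S \<Longrightarrow> f s \<in> span T"
  shows "f y \<in> span T"
proof -
  have "span S \<subseteq> f -` span T"
    using assms(1,3) by (intro span_minimal linear_subspace_vimage) auto
  then show ?thesis using assms(2) by auto
qed

lemma subspace_closure:
  fixes S :: "'a::real_normed_vector set"
  assumes "subspace S"
  shows "subspace (closure S)"
  unfolding subspace_def
proof (intro conjI allI ballI)
  show "0 \<in> closure S"
    using subspace_0[OF assms] closure_subset by blast
next
  fix x y assume "x \<in> closure S" "y \<in> closure S"
  then obtain f g where "\<forall>n. f n \<in> S" "f \<longlonglongrightarrow> x" "\<forall>n. g n \<in> S" "g \<longlonglongrightarrow> y"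
    by (auto simp: closure_sequential)
  then show "x + y \<in> closure S"
    unfolding closure_sequential using subspace_add[OF assms]
    by (intro exI[of _ "\<lambda>n. f n + g n"]) (auto intro: tendsto_add)
next
  fix c x assume "x \<in> closure S"
  then obtain f where "\<forall>n. f n \<in> S" "f \<longlonglongrightarrow> x"
    by (auto simp: closure_sequential)
  then show "c *\<^sub>R x \<in> closure S"
    unfolding closure_sequential using subspace_scale[OF assms]
    by (intro exI[of _ "\<lambda>n. c *\<^sub>R f n"]) (auto intro: tendsto_scaleR)
qed

section \<open>Shifts as linear isometries and their composition law\<close>

lemma L2_norm_tf_shift: "L2_norm (tf_shift f p) = L2_norm f"
proof -
  have "integral\<^sup>L lborel (\<lambda>t. (cmod (f t))\<^sup>2) =
      \<bar>1\<bar> *\<^sub>R integral\<^sup>L lborel (\<lambda>t. (cmod (f (- fst p + 1 * t)))\<^sup>2)"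
    by (rule lborel_integral_real_affine) simp
  then show ?thesis
    by (simp add: L2_norm_def tf_shift_def norm_mult)
qed

lemma in_L2_tf_shift:
  assumes "in_L2 f"
  shows "in_L2 (tf_shift f p)"
proof -
  have "integrable lborel (\<lambda>t. (cmod (f (- fst p + 1 * t)))\<^sup>2)"
    by (rule lborel_integrable_real_affine[where f = "\<lambda>t. (cmod (f t))\<^sup>2"])
      (use in_L2D[OF assms] in auto)
  moreover have "tf_shift f p \<in> borel_measurable borel"
    using in_L2D(1)[OF assms] unfolding tf_shift_def cis_conv_exp by measurable
  ultimately show ?thesis
    by (simp add: in_L2_def tf_shift_def norm_mult)
qed

lift_definition tf :: "real \<times> real \<Rightarrow> l2 \<Rightarrow> l2" is "\<lambda>p f. tf_shift f p"
proof -
  fix p :: "real \<times> real" and f g :: "real \<Rightarrow> complex"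
  assume *: "in_L2 f \<and> in_L2 g \<and> (AE t in lborel. f t = g t)"
  then have [measurable]: "f \<in> borel_measurable borel" "g \<in> borel_measurable borel"
    by (auto dest: in_L2D)
  have "AE t in lborel. f (- fst p + 1 * t) = g (- fst p + 1 * t)"
    by (rule AE_borel_affine[where P = "\<lambda>t. f t = g t"]) (use * in auto)
  then show "in_L2 (tf_shift f p) \<and> in_L2 (tf_shift g p) \<and>
      (AE t in lborel. tf_shift f p t = tf_shift g p t)"
    using * by (auto simp: tf_shift_def intro: in_L2_tf_shift[unfolded tf_shift_def])
qed

lemma abs_l2_tf: "in_L2 f \<Longrightarrow> tf p (abs_l2 f) = abs_l2 (tf_shift f p)"
  by (simp add: tf.abs_eq)

lemma linear_tf: "linear (tf p)"
proof (rule linearI; transfer; intro conjI)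
  fix p r and f g :: "real \<Rightarrow> complex"
  assume f: "in_L2 f \<and> in_L2 f \<and> (AE t in lborel. f t = f t)"
  then show "in_L2 (tf_shift (\<lambda>t. r *\<^sub>R f t) p)" "in_L2 (\<lambda>t. r *\<^sub>R tf_shift f p t)"
    by (simp_all add: in_L2_tf_shift in_L2_scaleR)
  assume "in_L2 g \<and> in_L2 g \<and> (AE t in lborel. g t = g t)"
  then show "in_L2 (tf_shift (\<lambda>t. f t + g t) p)" "in_L2 (\<lambda>t. tf_shift f p t + tf_shift g p t)"
    using f by (simp_all add: in_L2_tf_shift in_L2_add)
qed (simp_all add: tf_shift_def distrib_left)

lemma norm_tf: "norm (tf p x) = norm x"
proof -
  obtain f where "in_L2 f" "x = abs_l2 f"
    by (rule abs_l2_cases)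
  then show ?thesis
    by (simp add: abs_l2_tf norm_abs_l2 in_L2_tf_shift L2_norm_tf_shift)
qed

lemma tf_cscale: "tf p (cscale z x) = cscale z (tf p x)"
proof (transfer, intro conjI)
  fix p z and f :: "real \<Rightarrow> complex"
  assume "in_L2 f \<and> in_L2 f \<and> (AE t in lborel. f t = f t)"
  then show "in_L2 (tf_shift (\<lambda>t. z * f t) p)" "in_L2 (\<lambda>t. z * tf_shift f p t)"
    by (auto intro!: in_L2_mult in_L2_tf_shift)
qed (simp add: tf_shift_def)

text \<open>Translating by \<open>fst p\<close> changes the modulation by \<open>snd q\<close> only
  by a constant phase. Shifts thus form a group up to unimodular factors, and spans with complex
  coefficients do not see these factors.\<close>

lemma tf_tf: "tf p (tf q x) = cscale (cis (- 2 * pi * snd q * fst p)) (tf (p + q) x)"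
proof (transfer, intro conjI)
  fix p q and f :: "real \<Rightarrow> complex"
  assume "in_L2 f \<and> in_L2 f \<and> (AE t in lborel. f t = f t)"
  then show "in_L2 (tf_shift (tf_shift f q) p)"
    "in_L2 (\<lambda>t. cis (- 2 * pi * snd q * fst p) * tf_shift f (p + q) t)"
    by (auto intro!: in_L2_mult in_L2_tf_shift)
  have "tf_shift (tf_shift f q) p t = cis (- 2 * pi * snd q * fst p) * tf_shift f (p + q) t" for t
  proof -
    have "tf_shift (tf_shift f q) p t =
        (cis (2 * pi * snd p * t) * cis (2 * pi * snd q * (t - fst p))) * f (t - fst p - fst q)"
      by (simp add: tf_shift_def)
    also have "cis (2 * pi * snd p * t) * cis (2 * pi * snd q * (t - fst p)) =
        cis (- 2 * pi * snd q * fst p) * cis (2 * pi * (snd p + snd q) * t)"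
      by (simp add: cis_mult algebra_simps)
    finally show ?thesis
      by (simp add: tf_shift_def diff_diff_eq)
  qed
  then show "AE t in lborel. tf_shift (tf_shift f q) p t =
      cis (- 2 * pi * snd q * fst p) * tf_shift f (p + q) t"
    by simp
qed

lemma tf_add:
  "tf (p + q) x = cscale (cis (2 * pi * snd q * fst p)) (tf p (tf q x))"
  by (simp add: tf_tf cscale_cscale cis_mult cscale_one)

text \<open>
  Multiplication by \<^term>\<open>\<i>\<close> enters through the generators because \<^typ>\<open>l2\<close> is only a
  real inner product space.
\<close>
definition tf_span :: "l2 \<Rightarrow> (real \<times> real) set \<Rightarrow> l2 set" where
  "tf_span x P = span ((\<lambda>(p, z). cscale z (tf p x)) ` (P \<times> {1, \<i>}))"

lemma subspace_tf_span: "subspace (tf_span x P)"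
  by (simp add: tf_span_def)

lemma tf_span_mono: "P \<subseteq> Q \<Longrightarrow> tf_span x P \<subseteq> tf_span x Q"
  unfolding tf_span_def by (intro span_mono image_mono) auto

lemma cscale_tf_in_tf_span:
  assumes "p \<in> P"
  shows "cscale z (tf p x) \<in> tf_span x P"
proof -
  have gen: "cscale w (tf p x) \<in> tf_span x P" if "w = 1 \<or> w = \<i>" for w
    unfolding tf_span_def using assms that
    by (intro span_base image_eqI[of _ _ "(p, w)"]) auto
  have "cscale z (tf p x) = Re z *\<^sub>R cscale 1 (tf p x) + Im z *\<^sub>R cscale \<i> (tf p x)"
    using cscale_conv_scaleR[of z "tf p x"] by (simp add: cscale_one)
  then show ?thesis
    using gen subspace_tf_span by (auto intro!: subspace_add subspace_scale)
qed

lemma cscale_tf_span: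
  assumes "y \<in> tf_span x P"
  shows "cscale z y \<in> tf_span x P"
  unfolding tf_span_def
  by (rule linear_image_span_subset[OF linear_cscale assms[unfolded tf_span_def]])
    (auto simp: cscale_cscale tf_span_def[symmetric] intro!: cscale_tf_in_tf_span)

lemma tf_tf_span:
  assumes "y \<in> tf_span x P"
  shows "tf q y \<in> tf_span x ((+) q ` P)"
  unfolding tf_span_def
  by (rule linear_image_span_subset[OF linear_tf assms[unfolded tf_span_def]])
    (auto simp: cscale_cscale tf_cscale tf_tf tf_span_def[symmetric] intro!: cscale_tf_in_tf_span)

text \<open>The vectors with finite support form a subspace that contains every generator.
  Finiteness later places an approximant inside a bounded square.\<close>

lemma tf_span_finite_support:
  assumes "y \<in> tf_span x P"
  shows "\<exists>F\<subseteq>P. finite F \<and> y \<in> tf_span x F"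
proof -
  have "y \<in> {y. \<exists>F\<subseteq>P. finite F \<and> y \<in> tf_span x F}"
  proof (rule span_induct_subspace[OF assms[unfolded tf_span_def]])
    show "subspace {y. \<exists>F\<subseteq>P. finite F \<and> y \<in> tf_span x F}"
      unfolding subspace_def
    proof (intro conjI allI ballI)
      show "0 \<in> {y. \<exists>F\<subseteq>P. finite F \<and> y \<in> tf_span x F}"
        using subspace_0[OF subspace_tf_span] by (auto intro: exI[of _ "{}"])
    next
      fix y z assume "y \<in> {y. \<exists>F\<subseteq>P. finite F \<and> y \<in> tf_span x F}"
        "z \<in> {y. \<exists>F\<subseteq>P. finite F \<and> y \<in> tf_span x F}"
      then obtain F G where "F \<subseteq> P" "finite F" "y \<in> tf_span x F"
        "G \<subseteq> P" "finite G" "z \<in> tf_span x G"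
        by auto
      then have "F \<union> G \<subseteq> P \<and> finite (F \<union> G) \<and> y + z \<in> tf_span x (F \<union> G)"
        using tf_span_mono[of F "F \<union> G" x] tf_span_mono[of G "F \<union> G" x]
        by (auto intro!: subspace_add[OF subspace_tf_span])
      then show "y + z \<in> {y. \<exists>F\<subseteq>P. finite F \<and> y \<in> tf_span x F}"
        by blast
    next
      fix c y assume "y \<in> {y. \<exists>F\<subseteq>P. finite F \<and> y \<in> tf_span x F}"
      then show "c *\<^sub>R y \<in> {y. \<exists>F\<subseteq>P. finite F \<and> y \<in> tf_span x F}"
        using subspace_scale[OF subspace_tf_span] by blast
    qed
    fix s assume "s \<in> (\<lambda>(p, z). cscale z (tf p x)) ` (P \<times> {1, \<i>})"
    then obtain p z where "p \<in> P" "s = cscale z (tf p x)"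
      by auto
    then have "{p} \<subseteq> P \<and> finite {p} \<and> s \<in> tf_span x {p}"
      using cscale_tf_in_tf_span by auto
    then show "s \<in> {y. \<exists>F\<subseteq>P. finite F \<and> y \<in> tf_span x F}"
      by blast
  qed
  then show ?thesis by simp
qed

text \<open>Recovers complex coefficients from the real span, the form in which
  \<open>lin_span\<close> and hence uniform minimality are stated.\<close>

lemma tf_span_finite_sum:
  assumes F: "finite F" and y: "y \<in> tf_span x F"
  shows "\<exists>c. y = (\<Sum>p\<in>F. cscale (c p) (tf p x))"
proof -
  have "y \<in> {y. \<exists>c. y = (\<Sum>p\<in>F. cscale (c p) (tf p x))}"
  proof (rule span_induct_subspace[OF y[unfolded tf_span_def]])
    have add: "cscale (a + b) u = cscale a u + cscale b u" for a b u
      using cscale_conv_scaleR[of "a + b" u] cscale_conv_scaleR[of a u] cscale_conv_scaleR[of b u]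
      by (simp add: algebra_simps)
    have scale: "cscale (of_real r * a) u = r *\<^sub>R cscale a u" for r a u
      using cscale_conv_scaleR[of "of_real r * a" u] cscale_conv_scaleR[of a u]
      by (simp add: algebra_simps)
    show "subspace {y. \<exists>c. y = (\<Sum>p\<in>F. cscale (c p) (tf p x))}"
      unfolding subspace_def
    proof (intro conjI allI ballI)
      show "0 \<in> {y. \<exists>c. y = (\<Sum>p\<in>F. cscale (c p) (tf p x))}"
        using scale[of 0] by (auto intro!: exI[of _ "\<lambda>_. 0"])
    next
      fix y z assume "y \<in> {y. \<exists>c. y = (\<Sum>p\<in>F. cscale (c p) (tf p x))}"
        "z \<in> {y. \<exists>c. y = (\<Sum>p\<in>F. cscale (c p) (tf p x))}"
      then obtain c d where "y = (\<Sum>p\<in>F. cscale (c p) (tf p x))"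
        "z = (\<Sum>p\<in>F. cscale (d p) (tf p x))"
        by auto
      then have "y + z = (\<Sum>p\<in>F. cscale (c p + d p) (tf p x))"
        by (simp add: add sum.distrib)
      then show "y + z \<in> {y. \<exists>c. y = (\<Sum>p\<in>F. cscale (c p) (tf p x))}"
        by (auto intro!: exI[of _ "\<lambda>p. c p + d p"])
    next
      fix r y assume "y \<in> {y. \<exists>c. y = (\<Sum>p\<in>F. cscale (c p) (tf p x))}"
      then obtain c where "y = (\<Sum>p\<in>F. cscale (c p) (tf p x))"
        by auto
      then have "r *\<^sub>R y = (\<Sum>p\<in>F. cscale (of_real r * c p) (tf p x))"
        by (simp add: scale scaleR_sum_right)
      then show "r *\<^sub>R y \<in> {y. \<exists>c. y = (\<Sum>p\<in>F. cscale (c p) (tf p x))}"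
        by (auto intro!: exI[of _ "\<lambda>p. of_real r * c p"])
    qed
    fix s assume "s \<in> (\<lambda>(p, z). cscale z (tf p x)) ` (F \<times> {1, \<i>})"
    then obtain p z where p: "p \<in> F" and s: "s = cscale z (tf p x)"
      by auto
    have "(\<Sum>q\<in>F. cscale (if q = p then z else 0) (tf q x)) = (\<Sum>q\<in>F. if q = p then s else 0)"
      using scale[of 0] s by (intro sum.cong) auto
    also have "\<dots> = s"
      using F p by simp
    finally show "s \<in> {y. \<exists>c. y = (\<Sum>p\<in>F. cscale (c p) (tf p x))}"
      by (auto intro!: exI[of _ "\<lambda>q. if q = p then z else 0"])
  qed
  then show ?thesis by simp
qed

subsection \<open>Density of the lattice system\<close>

text \<open>The interval is half-open so that its integer translates partition the line.\<close>

definition unit_ind :: "real \<Rightarrow> complex" where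
  "unit_ind t = indicator {0..<1} t"

definition chi :: l2 where
  "chi = abs_l2 unit_ind"

lemma in_L2_bounded_support:
  assumes "f \<in> borel_measurable borel" "\<And>t. cmod (f t) \<le> B * indicator {-r..r} t"
  shows "in_L2 f"
proof -
  have "integrable lborel (\<lambda>t. B\<^sup>2 * indicator {-r..r} t :: real)"
    by (intro integrable_mult_right integrable_real_indicator) (auto simp: emeasure_lborel_Icc_eq)
  then have "integrable lborel (\<lambda>t. (cmod (f t))\<^sup>2)"
  proof (rule Bochner_Integration.integrable_bound)
    have "(cmod (f t))\<^sup>2 \<le> B\<^sup>2 * indicator {-r..r} t" for t
      using power_mono[OF assms(2)[of t], of 2] by (auto simp: power_mult_distrib indicator_def)
    then show "AE t in lborel. norm ((cmod (f t))\<^sup>2) \<le> norm (B\<^sup>2 * indicator {-r..r} t :: real)"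
      by auto
  qed (use assms(1) in measurable)
  then show ?thesis
    using assms(1) by (simp add: in_L2_def)
qed

lemma in_L2_indicator: "in_L2 (\<lambda>t. z * indicator {-r..r} t)"
  by (rule in_L2_bounded_support[of _ "cmod z" r]) (auto simp: norm_mult indicator_def)

lemma in_L2_unit_ind: "in_L2 unit_ind"
  unfolding unit_ind_def
  by (rule in_L2_bounded_support[of _ 1 1]) (auto simp: indicator_def)

section \<open>Trigonometric polynomials of period 1\<close>

inductive trig_poly :: "(real \<Rightarrow> complex) \<Rightarrow> bool" where
  monomial: "trig_poly (\<lambda>t. z * cis (2 * pi * of_int m * t))"
| add: "trig_poly u \<Longrightarrow> trig_poly v \<Longrightarrow> trig_poly (\<lambda>t. u t + v t)"

lemma trig_poly_const: "trig_poly (\<lambda>t. z)"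
  using trig_poly.monomial[of z 0] by simp

lemma trig_poly_mult:
  assumes "trig_poly u" "trig_poly v"
  shows "trig_poly (\<lambda>t. u t * v t)"
  using assms(1)
proof induction
  case (monomial z m)
  show ?case using assms(2)
  proof induction
    case (monomial w n)
    have "(\<lambda>t. z * cis (2 * pi * of_int m * t) * (w * cis (2 * pi * of_int n * t))) =
        (\<lambda>t. (z * w) * cis (2 * pi * of_int (m + n) * t))"
    proof
      fix t
      have "cis (2 * pi * of_int (m + n) * t) = cis (2 * pi * of_int m * t) * cis (2 * pi * of_int n * t)"
        by (simp add: cis_mult algebra_simps)
      then show "z * cis (2 * pi * of_int m * t) * (w * cis (2 * pi * of_int n * t)) =
        (z * w) * cis (2 * pi * of_int (m + n) * t)"
        by (simp add: mult_ac)
    qed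
    then show ?case
      using trig_poly.monomial[of "z * w" "m + n"] by simp
  next
    case (add u v)
    then show ?case using trig_poly.add by (simp add: distrib_left)
  qed
next
  case (add u1 u2)
  then show ?case using trig_poly.add by (simp add: distrib_right)
qed

text \<open>A real linear form is \<open>a * cos s + b * sin s\<close> on the unit circle, hence a
  combination of \<open>cis s\<close> and \<open>cis (- s)\<close>. Sums and products stay
  trigonometric polynomials.\<close>

lemma trig_poly_real_polynomial_function:
  assumes "real_polynomial_function p"
  shows "trig_poly (\<lambda>t. of_real (p (cis (2 * pi * t))))"
  using assms
proof induction
  case (linear f)
  define a b where "a = f 1" and "b = f \<i>"
  have "complex_of_real (f (cis s)) = (of_real a - \<i> * of_real b) / 2 * cis s
      + (of_real a + \<i> * of_real b) / 2 * cis (- s)" for s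
  proof -
    have "cis s = cos s *\<^sub>R 1 + sin s *\<^sub>R \<i>"
      by (simp add: complex_eq_iff)
    then have "f (cis s) = cos s * a + sin s * b"
      using linear_add[OF bounded_linear.linear[OF linear]] linear_scale[OF bounded_linear.linear[OF linear]]
      by (simp add: a_def b_def)
    then show ?thesis
      by (simp add: complex_eq_iff field_simps)
  qed
  then have eq: "(\<lambda>t. complex_of_real (f (cis (2 * pi * t)))) =
    (\<lambda>t. (of_real a - \<i> * of_real b) / 2 * cis (2 * pi * of_int 1 * t)
      + (of_real a + \<i> * of_real b) / 2 * cis (2 * pi * of_int (-1) * t))"
    by auto
  then show ?case
    by (subst eq) (rule trig_poly.add[OF trig_poly.monomial trig_poly.monomial])
next
  case (const c)
  show ?case by (rule trig_poly_const)
next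
  case (add f g)
  then show ?case using trig_poly.add by simp
next
  case (mult f g)
  then show ?case using trig_poly_mult by simp
qed

lemma trig_poly_polynomial_function:
  fixes q :: "complex \<Rightarrow> complex"
  assumes "polynomial_function q"
  shows "trig_poly (\<lambda>t. q (cis (2 * pi * t)))"
proof -
  have "real_polynomial_function (Re \<circ> q)" "real_polynomial_function (Im \<circ> q)"
    using assms bounded_linear_Re bounded_linear_Im by (auto simp: polynomial_function_def)
  then have "trig_poly (\<lambda>t. of_real ((Re \<circ> q) (cis (2 * pi * t))) +
      \<i> * of_real ((Im \<circ> q) (cis (2 * pi * t))))"
    by (intro trig_poly.add trig_poly_mult trig_poly_const trig_poly_real_polynomial_function)
  then show ?thesis
    by (simp flip: complex_eq)
qed

section \<open>Approximation by lattice shifts on unit intervals\<close>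

abbreviation int_lattice :: "(real \<times> real) set" where
  "int_lattice \<equiv> \<int> \<times> \<int>"

text \<open>A character of integer frequency, restricted to an integer translate of the unit
  interval, is exactly a lattice shift of \<open>unit_ind\<close>.\<close>

lemma trig_poly_in_tf_span:
  assumes "trig_poly u"
  shows "in_L2 (\<lambda>t. u t * unit_ind (t - of_int k)) \<and>
    abs_l2 (\<lambda>t. u t * unit_ind (t - of_int k)) \<in> tf_span chi int_lattice"
  using assms
proof induction
  case (monomial z m)
  have eq: "(\<lambda>t. z * cis (2 * pi * of_int m * t) * unit_ind (t - of_int k)) =
      (\<lambda>t. z * tf_shift unit_ind (of_int k, of_int m) t)"
    by (simp add: tf_shift_def fun_eq_iff)
  have "abs_l2 (\<lambda>t. z * tf_shift unit_ind (of_int k, of_int m) t)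
      = cscale z (tf (of_int k, of_int m) chi)"
    by (simp add: chi_def abs_l2_tf in_L2_unit_ind abs_l2_cscale in_L2_tf_shift)
  then show ?case
    unfolding eq using cscale_tf_in_tf_span[of "(of_int k, of_int m)" int_lattice z chi]
    by (auto intro: in_L2_mult in_L2_tf_shift in_L2_unit_ind)
next
  case (add u v)
  then show ?case
    using subspace_add[OF subspace_tf_span]
    by (auto simp: distrib_right in_L2_add simp flip: abs_l2_add)
qed

text \<open>Equal values at the two ends of the interval make \<open>h\<close> a continuous function
  on the circle, where Stone-Weierstrass yields uniform polynomial approximation; polynomials on the
  circle are trigonometric polynomials in \<open>t\<close>.\<close>

lemma periodic_continuous_in_closure:
  fixes h :: "real \<Rightarrow> complex" and k :: int
  assumes cont: "continuous_on UNIV h" and per: "h (of_int k) = h (of_int k + 1)"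
  shows "abs_l2 (\<lambda>t. h t * unit_ind (t - of_int k)) \<in> closure (tf_span chi int_lattice)"
proof -
  define p where "p s = h (of_int k + s)" for s
  have contp: "continuous_on {0..1} p"
    unfolding p_def by (intro continuous_intros continuous_on_compose2[OF cont]) auto
  \<comment> \<open>The trivial homotopy of the loop \<open>p\<close> to itself is used only to
    obtain continuity of the induced circle map, including at the point 1 where
    \<open>Arg2pi\<close> jumps.\<close>
  have "homotopic_loops UNIV p p"
    using contp per by (auto simp: homotopic_loops_refl path_def pathstart_def pathfinish_def p_def)
  then have contphi: "continuous_on (sphere 0 1) (p \<circ> (\<lambda>z. Arg2pi z / (2 * pi)))"
    using homotopic_loops_imp_homotopic_circlemaps homotopic_with_imp_continuous by blast
  have "\<exists>q. polynomial_function q \<and>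
      (\<forall>z\<in>sphere 0 1. norm ((p \<circ> (\<lambda>z. Arg2pi z / (2 * pi))) z - q z) < 1 / (real n + 1))" for n
    by (rule Stone_Weierstrass_polynomial_function[OF _ contphi]) auto
  then obtain q where q: "\<And>n. polynomial_function (q n)"
    "\<And>n z. z \<in> sphere 0 1 \<Longrightarrow> norm ((p \<circ> (\<lambda>z. Arg2pi z / (2 * pi))) z - q n z) < 1 / (real n + 1)"
    by metis
  define u where "u n t = q n (cis (2 * pi * t)) * unit_ind (t - of_int k)" for n t
  define f where "f t = h t * unit_ind (t - of_int k)" for t
  have ind: "unit_ind (t - of_int k) = (if of_int k \<le> t \<and> t < of_int k + 1 then 1 else 0)" for t
    by (auto simp: unit_ind_def indicator_def)
  have close: "cmod (u n t - f t) \<le> 1 / (real n + 1)" for n t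
  proof (cases "of_int k \<le> t \<and> t < of_int k + 1")
    case True
    have "cis (2 * pi * t) = cis (2 * pi * (t - of_int k)) * cis (2 * pi * of_int k)"
      by (simp add: cis_mult algebra_simps)
    also have "cis (2 * pi * of_int k) = 1"
      by (rule cis_multiple_2pi) simp
    finally have "Arg2pi (cis (2 * pi * t)) = 2 * pi * (t - of_int k)"
      using True by (intro Arg2pi_unique[of 1]) (auto simp: cis_conv_exp)
    then have "(p \<circ> (\<lambda>z. Arg2pi z / (2 * pi))) (cis (2 * pi * t)) = h t"
      by (simp add: p_def)
    then have "cmod (h t - q n (cis (2 * pi * t))) < 1 / (real n + 1)"
      using q(2)[of "cis (2 * pi * t)" n] by simp
    then show ?thesis
      using True by (simp add: u_def f_def ind norm_minus_commute)
  next
    case False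
    then have "unit_ind (t - of_int k) = 0"
      by (auto simp: ind)
    then show ?thesis by (simp add: u_def f_def)
  qed
  have "compact (h ` {of_int k..of_int k + 1})"
    by (intro compact_continuous_image continuous_on_subset[OF cont]) auto
  then obtain B where B: "\<And>t. of_int k \<le> t \<Longrightarrow> t \<le> of_int k + 1 \<Longrightarrow> cmod (h t) \<le> B"
    by (force dest!: compact_imp_bounded simp: bounded_iff)
  define r where "r = \<bar>real_of_int k\<bar> + 1"
  have trig: "trig_poly (\<lambda>t. q n (cis (2 * pi * t)))" for n
    using trig_poly_polynomial_function[OF q(1)] .
  have "(\<lambda>n. abs_l2 (u n)) \<longlonglongrightarrow> abs_l2 f"
  \<comment> \<open>\<open>B\<close> bounds \<open>h\<close> on the interval and the approximation
    error is at most 1; \<open>r\<close> is large enough for the interval to lie in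
    \<open>{-r..r}\<close>.\<close>
  proof (rule tendsto_abs_l2(3)[where G = "\<lambda>t. of_real (\<bar>B\<bar> + 1) * indicator {-r..r} t"])
    show "u n \<in> borel_measurable borel" for n
      using trig_poly_in_tf_span[OF trig[of n], of k] unfolding u_def by (auto dest: in_L2D)
    have "(\<lambda>t. unit_ind (t - of_int k)) \<in> borel_measurable borel"
      using in_L2D(1)[OF in_L2_unit_ind] by measurable
    then show "f \<in> borel_measurable borel"
      unfolding f_def using borel_measurable_continuous_onI[OF cont] by measurable
    have "(\<lambda>n. u n t) \<longlonglongrightarrow> f t" for t
    proof (rule LIM_zero_cancel, rule Lim_null_comparison)
      show "(\<lambda>n. 1 / (real n + 1)) \<longlonglongrightarrow> 0"
        using LIMSEQ_inverse_real_of_nat by (simp add: inverse_eq_divide add.commute)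
    qed (use close in auto)
    then show "AE t in lborel. (\<lambda>n. u n t) \<longlonglongrightarrow> f t"
      by simp
    have "cmod (u n t) \<le> cmod (of_real (\<bar>B\<bar> + 1) * indicator {-r..r} t)" for n t
    proof (cases "of_int k \<le> t \<and> t < of_int k + 1")
      case True
      have "cmod (u n t) \<le> cmod (f t) + cmod (u n t - f t)"
        by (rule norm_triangle_sub)
      moreover have "cmod (f t) \<le> B"
        using True B[of t] by (simp add: f_def ind)
      moreover have "1 / (real n + 1) \<le> 1"
        by simp
      ultimately have "cmod (u n t) \<le> \<bar>B\<bar> + 1"
        using close[of n t] by linarith
      moreover have "t \<in> {-r..r}"
        using True by (auto simp: r_def)
      ultimately show ?thesis
        by (simp add: norm_mult)
    next
      case False
      then have "unit_ind (t - of_int k) = 0"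
        by (auto simp: ind)
      then show ?thesis by (simp add: u_def)
    qed
    then show "AE t in lborel. cmod (u n t) \<le> cmod (of_real (\<bar>B\<bar> + 1) * indicator {-r..r} t)" for n
      by simp
  qed (rule in_L2_indicator)
  moreover have "abs_l2 (u n) \<in> tf_span chi int_lattice" for n
    using trig_poly_in_tf_span[OF trig[of n], of k] unfolding u_def by auto
  ultimately show ?thesis
    unfolding closure_sequential f_def[symmetric] by (intro exI[of _ "\<lambda>n. abs_l2 (u n)"]) simp
qed

lemma unit_ind_of_int: "unit_ind (t - of_int k) = (if k = \<lfloor>t\<rfloor> then 1 else 0)"
  by (auto simp: unit_ind_def indicator_def floor_unique) linarith+

lemma unit_ind_measurable [measurable]: "unit_ind \<in> borel_measurable borel"
  using in_L2D(1)[OF in_L2_unit_ind] .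

text \<open>A measurable function is an almost everywhere limit of continuous functions
  \<open>g n\<close>. Clipping their values gives a common bound, and a cutoff vanishing at both
  ends of the interval gives the equal end values that the periodic case demands.\<close>

lemma bounded_in_closure:
  fixes f :: "real \<Rightarrow> complex"
  assumes [measurable]: "f \<in> borel_measurable borel" and bound: "\<And>t. cmod (f t) \<le> B"
  shows "abs_l2 (\<lambda>t. f t * unit_ind (t - of_int k)) \<in> closure (tf_span chi int_lattice)"
proof -
  have "f measurable_on UNIV"
    by (rule lebesgue_measurable_imp_measurable_on) (auto intro: measurable_completion)
  then obtain N g where N: "negligible N" and g: "\<And>n. continuous_on UNIV (g n)"
    and lim: "\<And>t. t \<notin> N \<Longrightarrow> (\<lambda>n. g n t) \<longlonglongrightarrow> f t"
    unfolding measurable_on_def by auto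
  define C where "C = \<bar>B\<bar> + 1"
  have C: "C > 0" "\<And>t. cmod (f t) \<le> C"
    unfolding C_def using bound by (auto intro: order_trans[OF bound])
  \<comment> \<open>This is the radial retraction onto the disc of radius \<open>C\<close>; it fixes
    the values of \<open>f\<close>.\<close>
  define clip where "clip z = (C / max C (cmod z)) *\<^sub>R z" for z :: complex
  have clip_cont: "continuous_on UNIV clip"
    unfolding clip_def using C(1) by (intro continuous_intros) (auto simp: max_def)
  have clip_le: "cmod (clip z) \<le> C" for z
    using C(1) by (auto simp: clip_def max_def field_simps)
  \<comment> \<open>A continuous trapezoid that vanishes outside the open interval from
    \<open>k\<close> to \<open>k + 1\<close> and equals 1 at each interior point once
    \<open>n\<close> is large.\<close>
  define bump where "bump n t = min 1 (real n * max 0 (min (t - of_int k) (of_int k + 1 - t)))"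
    for n and t :: real
  define h where "h n t = bump n t *\<^sub>R clip (g n t)" for n t
  have bump: "0 \<le> bump n t" "bump n t \<le> 1" for n t
    by (auto simp: bump_def)
  have h_cont: "continuous_on UNIV (h n)" for n
    unfolding h_def bump_def
    by (intro continuous_intros continuous_on_compose2[OF clip_cont g]) auto
  have h_ends: "h n (of_int k) = h n (of_int k + 1)" for n
    by (simp add: h_def bump_def)
  define r where "r = \<bar>real_of_int k\<bar> + 1"
  have "(\<lambda>n. abs_l2 (\<lambda>t. h n t * unit_ind (t - of_int k)))
      \<longlonglongrightarrow> abs_l2 (\<lambda>t. f t * unit_ind (t - of_int k))"
  proof (rule tendsto_abs_l2(3)[where G = "\<lambda>t. of_real C * indicator {-r..r} t"])
    show "(\<lambda>t. h n t * unit_ind (t - of_int k)) \<in> borel_measurable borel" for n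
      using borel_measurable_continuous_onI[OF h_cont] by measurable
    have notin: "AE t in lborel. t \<notin> N"
      using N AE_not_in[of N lebesgue] by (simp add: negligible_iff_null_sets AE_completion_iff)
    \<comment> \<open>At \<open>t = k\<close> the cutoff is always 0 while \<open>unit_ind\<close>
      is 1, so this point is excluded along with the null set \<open>N\<close>.\<close>
    have point: "(\<lambda>n. h n t * unit_ind (t - of_int k)) \<longlonglongrightarrow> f t * unit_ind (t - of_int k)"
      if t: "t \<notin> N" "t \<noteq> of_int k" for t
    proof (cases "k = \<lfloor>t\<rfloor>")
      case True
      define d where "d = min (t - of_int k) (of_int k + 1 - t)"
      have d: "d > 0"
        using True t(2) unfolding d_def by (simp add: less_le floor_le_iff) linarith
      obtain m where m: "1 / d \<le> real m"
        using real_arch_simple by blast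
      have "bump n t = 1" if "n \<ge> m" for n
      proof -
        have "1 / d \<le> real n"
          using m that by (meson of_nat_le_iff order_trans)
        then have "1 \<le> real n * d"
          using d by (simp add: field_simps)
        then show ?thesis
          using d by (simp add: bump_def d_def[symmetric])
      qed
      then have "(\<lambda>n. bump n t) \<longlonglongrightarrow> 1"
        by (intro tendsto_eventually eventually_sequentiallyI[of m])
      moreover have "(\<lambda>n. clip (g n t)) \<longlonglongrightarrow> clip (f t)"
        using clip_cont lim[OF t(1)]
        by (auto simp: continuous_on_eq_continuous_at intro: isCont_tendsto_compose[of _ clip])
      moreover have "clip (f t) = f t"
        using C by (simp add: clip_def max_absorb1)
      ultimately have "(\<lambda>n. h n t) \<longlonglongrightarrow> f t"
        unfolding h_def by (auto intro: tendsto_eq_intros)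
      then show ?thesis
        by (intro tendsto_intros)
    next
      case False
      then show ?thesis
        by (simp add: unit_ind_of_int)
    qed
    show "AE t in lborel. (\<lambda>n. h n t * unit_ind (t - of_int k)) \<longlonglongrightarrow> f t * unit_ind (t - of_int k)"
      using notin AE_lborel_singleton[of "of_int k"] by eventually_elim (rule point)
    have "cmod (h n t * unit_ind (t - of_int k)) \<le> cmod (of_real C * indicator {-r..r} t)" for n t
    proof (cases "k = \<lfloor>t\<rfloor>")
      case True
      have "cmod (h n t) \<le> 1 * C"
        unfolding h_def norm_scaleR using bump[of n t] clip_le C(1) by (intro mult_mono) auto
      moreover have "t \<in> {-r..r}"
        using True unfolding r_def by simp linarith
      ultimately show ?thesis
        using True C(1) by (simp add: unit_ind_of_int norm_mult)
    qed (simp add: unit_ind_of_int)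
    then show "AE t in lborel. cmod (h n t * unit_ind (t - of_int k)) \<le> cmod (of_real C * indicator {-r..r} t)" for n
      by simp
  qed (measurable, rule in_L2_indicator)
  with periodic_continuous_in_closure[OF h_cont h_ends] show ?thesis
    by (rule closed_sequentially[OF closed_closure])
qed

text \<open>Truncating \<open>f\<close> in size to \<open>n\<close> and in time to
  \<open>-n \<le> t < n\<close> leaves a finite sum of bounded pieces on unit intervals, and these
  truncations converge to \<open>f\<close> in norm.\<close>

lemma tf_span_chi_dense: "closure (tf_span chi int_lattice) = UNIV"
proof -
  have "x \<in> closure (tf_span chi int_lattice)" for x
  proof -
    obtain f where f: "in_L2 f" "x = abs_l2 f"
      by (rule abs_l2_cases)
    have [measurable]: "f \<in> borel_measurable borel"
      using in_L2D[OF f(1)] by simp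
    define c where "c n t = (if cmod (f t) \<le> real n then f t else 0)" for n t
    have c_meas [measurable]: "c n \<in> borel_measurable borel" for n
      unfolding c_def by measurable
    have piece: "in_L2 (\<lambda>t. c n t * unit_ind (t - of_int k))" for n k
      by (rule in_L2_dominated[OF _ f(1)]) (measurable, auto simp: c_def unit_ind_of_int)
    define u where "u n t = (\<Sum>k\<in>{- int n..<int n}. c n t * unit_ind (t - of_int k))" for n t
    have u: "u n t = (if \<lfloor>t\<rfloor> \<in> {- int n..<int n} then c n t else 0)" for n t
      by (simp add: u_def unit_ind_of_int if_distrib[of "\<lambda>z. _ * z"] cong: if_cong)
    have lim: "(\<lambda>n. abs_l2 (u n)) \<longlonglongrightarrow> abs_l2 f"
    proof (rule tendsto_abs_l2(3)[OF _ _ f(1)])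
      show "u n \<in> borel_measurable borel" for n
        unfolding u_def by measurable
      have "(\<lambda>n. u n t) \<longlonglongrightarrow> f t" for t
      proof -
        obtain m where m: "cmod (f t) + \<bar>t\<bar> + 1 \<le> real m"
          using real_arch_simple by blast
        have "u n t = f t" if "n \<ge> m" for n
        proof -
          have n: "cmod (f t) + \<bar>t\<bar> + 1 \<le> real n"
            using m that by (meson of_nat_le_iff order_trans)
          then have "cmod (f t) \<le> real n" and a: "\<bar>t\<bar> + 1 \<le> real n"
            using norm_ge_zero[of "f t"] by linarith+
          moreover have "\<lfloor>t\<rfloor> \<in> {- int n..<int n}"
            using a by (simp add: le_floor_iff floor_less_iff) linarith
          ultimately show ?thesis
            by (simp add: u c_def)
        qed
        then show ?thesis
          by (intro tendsto_eventually eventually_sequentiallyI[of m])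
      qed
      then show "AE t in lborel. (\<lambda>n. u n t) \<longlonglongrightarrow> f t"
        by simp
    qed (auto simp: u c_def)
    have "abs_l2 (u n) \<in> closure (tf_span chi int_lattice)" for n
    proof -
      have "abs_l2 (u n) = (\<Sum>k\<in>{- int n..<int n}. abs_l2 (\<lambda>t. c n t * unit_ind (t - of_int k)))"
        unfolding u_def by (rule abs_l2_sum[symmetric]) (auto intro: piece)
      also have "\<dots> \<in> closure (tf_span chi int_lattice)"
        by (intro subspace_sum subspace_closure subspace_tf_span bounded_in_closure[where B = "real n"])
          (auto simp: c_def)
      finally show ?thesis .
    qed
    then show ?thesis
      unfolding f(2) by (rule closed_sequentially[OF closed_closure _ lim])
  qed
  then show ?thesis by auto
qed

subsection \<open>Homogeneous approximation\<close>

lemma square_mono: "r \<le> s \<Longrightarrow> square c r \<subseteq> square c s"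
  by (auto simp: square_def)

section \<open>Continuity of the shifts of \<open>chi\<close> and compactness of the unit
  square\<close>

lemma tendsto_unit_ind:
  assumes "a \<longlonglongrightarrow> l" "l \<noteq> 0" "l \<noteq> 1"
  shows "(\<lambda>n. unit_ind (a n)) \<longlonglongrightarrow> unit_ind l"
proof (rule tendsto_eventually)
  consider "l < 0" | "0 < l" "l < 1" | "l > 1"
    using assms(2,3) by linarith
  then show "\<forall>\<^sub>F n in sequentially. unit_ind (a n) = unit_ind l"
  proof cases
    case 1
    show ?thesis
      using order_tendstoD(2)[OF assms(1) 1]
      by eventually_elim (use 1 in \<open>auto simp: unit_ind_def\<close>)
  next
    case 2
    show ?thesis
      using order_tendstoD(2)[OF assms(1) 2(2)] order_tendstoD(1)[OF assms(1) 2(1)]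
      by eventually_elim (use 2 in \<open>auto simp: unit_ind_def\<close>)
  next
    case 3
    show ?thesis
      using order_tendstoD(1)[OF assms(1) 3]
      by eventually_elim (use 3 in \<open>auto simp: unit_ind_def\<close>)
  qed
qed

text \<open>Pointwise convergence can fail only at the two jumps of the limiting indicator. A
  convergent sequence of translations is bounded, so all supports lie in one interval and a multiple
  of its indicator dominates.\<close>

lemma tendsto_tf_chi:
  assumes m: "m \<longlonglongrightarrow> l"
  shows "(\<lambda>n. tf (m n) chi) \<longlonglongrightarrow> tf l chi"
proof -
  have m1: "(\<lambda>n. fst (m n)) \<longlonglongrightarrow> fst l" and m2: "(\<lambda>n. snd (m n)) \<longlonglongrightarrow> snd l"
    using m by (auto intro: tendsto_fst tendsto_snd)
  then obtain C where C: "\<And>n. \<bar>fst (m n)\<bar> \<le> C"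
    using convergent_imp_Bseq[of "\<lambda>n. fst (m n)"] by (auto simp: convergent_def Bseq_def)
  define r where "r = C + 1"
  have "(\<lambda>n. abs_l2 (tf_shift unit_ind (m n))) \<longlonglongrightarrow> abs_l2 (tf_shift unit_ind l)"
  proof (rule tendsto_abs_l2(3)[where G = "\<lambda>t. 1 * indicator {-r..r} t"])
    show "tf_shift unit_ind p \<in> borel_measurable borel" for p
      using in_L2D(1)[OF in_L2_tf_shift[OF in_L2_unit_ind]] .
    have point: "(\<lambda>n. tf_shift unit_ind (m n) t) \<longlonglongrightarrow> tf_shift unit_ind l t"
      if "t \<noteq> fst l" "t \<noteq> fst l + 1" for t
      unfolding tf_shift_def cis_conv_exp
      using that by (intro tendsto_intros m2 tendsto_unit_ind m1) auto
    show "AE t in lborel. (\<lambda>n. tf_shift unit_ind (m n) t) \<longlonglongrightarrow> tf_shift unit_ind l t"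
      using AE_lborel_singleton[of "fst l"] AE_lborel_singleton[of "fst l + 1"]
      by eventually_elim (rule point)
    have "cmod (tf_shift unit_ind (m n) t) \<le> cmod (1 * indicator {-r..r} t)" for n t
      using C[of n] by (auto simp: tf_shift_def norm_mult unit_ind_def indicator_def r_def)
    then show "AE t in lborel. cmod (tf_shift unit_ind (m n) t) \<le> cmod (1 * indicator {-r..r} t)" for n
      by simp
  qed (rule in_L2D(1)[OF in_L2_tf_shift[OF in_L2_unit_ind]], rule in_L2_indicator)
  then show ?thesis
    by (simp add: chi_def abs_l2_tf in_L2_unit_ind)
qed

lemma finite_subset_square:
  assumes "finite F"
  shows "\<exists>n::nat. F \<subseteq> square (0, 0) (real n)"
proof -
  obtain n where n: "(\<Sum>p\<in>F. \<bar>fst p\<bar> + \<bar>snd p\<bar>) \<le> real n"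
    using real_arch_simple by blast
  have "\<bar>fst p\<bar> + \<bar>snd p\<bar> \<le> real n" if "p \<in> F" for p
    using member_le_sum[OF that _ assms, of "\<lambda>p. \<bar>fst p\<bar> + \<bar>snd p\<bar>"] n by auto
  then have "F \<subseteq> square (0, 0) (real n)"
    by (force simp: square_def)
  then show ?thesis by blast
qed

text \<open>If no radius sufficed, the bad shifts would accumulate at some \<open>l\<close>. By
  density a finite lattice combination is close to \<open>tf l chi\<close>, hence to the bad shifts
  far along the subsequence, whose squares eventually contain its support.\<close>

lemma tf_chi_approx_compact:
  assumes e: "e > 0"
  shows "\<exists>n::nat. \<forall>p\<in>{0..1} \<times> {0..1}.
    \<exists>y\<in>tf_span chi (int_lattice \<inter> square (0, 0) (real n)). norm (tf p chi - y) \<le> e"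
proof (rule ccontr)
  assume "\<not> ?thesis"
  then have "\<forall>n::nat. \<exists>p\<in>{0..1} \<times> {0..1}.
      \<forall>y\<in>tf_span chi (int_lattice \<inter> square (0, 0) (real n)). e < norm (tf p chi - y)"
    by (simp add: not_le)
  then obtain m where m: "\<And>n. m n \<in> {0..1} \<times> {0..1}"
    and far: "\<And>n y. y \<in> tf_span chi (int_lattice \<inter> square (0, 0) (real n)) \<Longrightarrow> e < norm (tf (m n) chi - y)"
    by metis
  have "compact ({0..1::real} \<times> {0..1::real})"
    by (intro compact_Times compact_Icc)
  then obtain l s where s: "strict_mono s" and l: "(m \<circ> s) \<longlonglongrightarrow> l"
    using m unfolding compact_def by blast
  have "tf l chi \<in> closure (tf_span chi int_lattice)"
    using tf_span_chi_dense by simp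
  then obtain y where y: "y \<in> tf_span chi int_lattice" "dist y (tf l chi) < e / 2"
    using e by (metis closure_approachable half_gt_zero)
  obtain F where F: "F \<subseteq> int_lattice" "finite F" "y \<in> tf_span chi F"
    using tf_span_finite_support[OF y(1)] by blast
  obtain N where N: "F \<subseteq> square (0, 0) (real N)"
    using finite_subset_square[OF F(2)] by blast
  have "(\<lambda>n. tf (m (s n)) chi) \<longlonglongrightarrow> tf l chi"
    using tendsto_tf_chi[OF l] by simp
  then have "\<forall>\<^sub>F n in sequentially. dist (tf (m (s n)) chi) (tf l chi) < e / 2"
    using e by (intro tendstoD) auto
  then obtain n where n: "n \<ge> N" "dist (tf (m (s n)) chi) (tf l chi) < e / 2"
    unfolding eventually_sequentially by (meson nle_le)
  have "real N \<le> real (s n)"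
    using n(1) seq_suble[OF s, of n] by linarith
  then have "F \<subseteq> int_lattice \<inter> square (0, 0) (real (s n))"
    using F(1) N square_mono by blast
  then have "y \<in> tf_span chi (int_lattice \<inter> square (0, 0) (real (s n)))"
    using F(3) tf_span_mono by blast
  then have "e < dist (tf (m (s n)) chi) y"
    unfolding dist_norm by (rule far)
  moreover have "dist (tf (m (s n)) chi) y \<le> dist (tf (m (s n)) chi) (tf l chi) + dist y (tf l chi)"
    by (rule dist_triangle2)
  ultimately show False
    using n(2) y(2) by linarith
qed

text \<open>
  The homogeneous approximation property: the radius needed for a given accuracy does not
  depend on the time-frequency shift.
\<close>
definition homogeneously_approximable :: "l2 \<Rightarrow> bool" where
  "homogeneously_approximable x \<longleftrightarrow> (\<forall>e>0. \<exists>r. \<forall>p.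
     \<exists>y\<in>tf_span chi (int_lattice \<inter> square p r). norm (tf p x - y) \<le> e)"

text \<open>Splitting \<open>p\<close> into integer and fractional parts reduces to the unit square,
  because the lattice is invariant under integer shifts. The integer part is within 1 of
  \<open>p\<close> in each coordinate, so the radius grows by 1.\<close>

lemma homogeneously_approximable_chi: "homogeneously_approximable chi"
  unfolding homogeneously_approximable_def
proof (intro allI impI)
  fix e :: real assume "e > 0"
  then obtain n :: nat where n: "\<And>q. q \<in> {0..1} \<times> {0..1} \<Longrightarrow>
      \<exists>y\<in>tf_span chi (int_lattice \<inter> square (0, 0) (real n)). norm (tf q chi - y) \<le> e"
    using tf_chi_approx_compact by blast
  have "\<exists>y\<in>tf_span chi (int_lattice \<inter> square p (real n + 1)). norm (tf p chi - y) \<le> e" for p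
  proof -
    define k q :: "real \<times> real"
      where "k = (of_int \<lfloor>fst p\<rfloor>, of_int \<lfloor>snd p\<rfloor>)" and "q = (frac (fst p), frac (snd p))"
    have p: "p = k + q"
      by (simp add: k_def q_def frac_def prod_eq_iff)
    have "q \<in> {0..1} \<times> {0..1}"
      by (auto simp: q_def intro: less_imp_le[OF frac_lt_1])
    then obtain y where y: "y \<in> tf_span chi (int_lattice \<inter> square (0, 0) (real n))"
      "norm (tf q chi - y) \<le> e"
      using n by blast
    define z where "z = cscale (cis (2 * pi * snd q * fst k)) (tf k y)"
    have "(+) k ` (int_lattice \<inter> square (0, 0) (real n)) \<subseteq> int_lattice \<inter> square p (real n + 1)"
    proof -
      have "\<bar>of_int \<lfloor>a\<rfloor> + b - a\<bar> \<le> real n + 1" if "\<bar>b\<bar> \<le> real n" for a b :: real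
        using that by linarith
      then show ?thesis
        by (auto simp: k_def square_def)
    qed
    then have "z \<in> tf_span chi (int_lattice \<inter> square p (real n + 1))"
      using tf_tf_span[OF y(1), of k] tf_span_mono unfolding z_def
      by (intro cscale_tf_span) blast
    moreover have "norm (tf p chi - z) = norm (tf q chi - y)"
      unfolding p tf_add z_def
      by (simp add: norm_cscale norm_tf linear_diff[OF linear_cscale, symmetric]
          linear_diff[OF linear_tf, symmetric])
    ultimately show ?thesis
      using y(2) by (intro bexI[of _ z]) simp_all
  qed
  then show "\<exists>r. \<forall>p. \<exists>y\<in>tf_span chi (int_lattice \<inter> square p r). norm (tf p chi - y) \<le> e"
    by blast
qed

text \<open>Up to a phase, shifting by \<open>q\<close> and then by \<open>p\<close> is shifting by
  \<open>p + q\<close>, and a square around \<open>p + q\<close> lies in a larger one around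
  \<open>p\<close> whose radius depends on \<open>q\<close> only through a fixed increment.\<close>

lemma homogeneously_approximable_shift:
  assumes "homogeneously_approximable x"
  shows "homogeneously_approximable (cscale z (tf q x))"
  unfolding homogeneously_approximable_def
proof (intro allI impI)
  fix e :: real assume e: "e > 0"
  \<comment> \<open>The summand 1 keeps the denominator positive when \<open>z\<close> is 0.\<close>
  then have "e / (cmod z + 1) > 0"
    by (simp add: add_nonneg_pos)
  then obtain r where r: "\<And>p. \<exists>y\<in>tf_span chi (int_lattice \<inter> square p r). norm (tf p x - y) \<le> e / (cmod z + 1)"
    using assms unfolding homogeneously_approximable_def by blast
  have "\<exists>y\<in>tf_span chi (int_lattice \<inter> square p (r + (\<bar>fst q\<bar> + \<bar>snd q\<bar>))).
      norm (tf p (cscale z (tf q x)) - y) \<le> e" for p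
  proof -
    obtain y where y: "y \<in> tf_span chi (int_lattice \<inter> square (p + q) r)"
      "norm (tf (p + q) x - y) \<le> e / (cmod z + 1)"
      using r by blast
    define w where "w = z * cis (- 2 * pi * snd q * fst p)"
    have "square (p + q) r \<subseteq> square p (r + (\<bar>fst q\<bar> + \<bar>snd q\<bar>))"
      by (auto simp: square_def)
    then have "tf_span chi (int_lattice \<inter> square (p + q) r)
        \<subseteq> tf_span chi (int_lattice \<inter> square p (r + (\<bar>fst q\<bar> + \<bar>snd q\<bar>)))"
      by (intro tf_span_mono) blast
    then have "cscale w y \<in> tf_span chi (int_lattice \<inter> square p (r + (\<bar>fst q\<bar> + \<bar>snd q\<bar>)))"
      using y(1) by (intro cscale_tf_span) blast
    moreover have "tf p (cscale z (tf q x)) - cscale w y = cscale w (tf (p + q) x - y)"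
      by (simp add: tf_cscale tf_tf cscale_cscale w_def linear_diff[OF linear_cscale])
    then have "norm (tf p (cscale z (tf q x)) - cscale w y) = cmod z * norm (tf (p + q) x - y)"
      by (simp add: norm_cscale w_def norm_mult)
    moreover have "cmod z * norm (tf (p + q) x - y) \<le> (cmod z + 1) * (e / (cmod z + 1))"
      using y(2) by (intro mult_mono) auto
    moreover have "(cmod z + 1) * (e / (cmod z + 1)) = e"
      using add_nonneg_pos[OF norm_ge_zero[of z] zero_less_one] by simp
    ultimately show ?thesis
      by (intro bexI[of _ "cscale w y"]) simp_all
  qed
  then show "\<exists>r. \<forall>p. \<exists>y\<in>tf_span chi (int_lattice \<inter> square p r).
      norm (tf p (cscale z (tf q x)) - y) \<le> e"
    by blast
qed

lemma homogeneously_approximable_add: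
  assumes "homogeneously_approximable x" "homogeneously_approximable y"
  shows "homogeneously_approximable (x + y)"
  unfolding homogeneously_approximable_def
proof (intro allI impI)
  fix e :: real assume "e > 0"
  then have "e / 2 > 0" by simp
  then obtain r s where r: "\<And>p. \<exists>u\<in>tf_span chi (int_lattice \<inter> square p r). norm (tf p x - u) \<le> e / 2"
    and s: "\<And>p. \<exists>v\<in>tf_span chi (int_lattice \<inter> square p s). norm (tf p y - v) \<le> e / 2"
    using assms unfolding homogeneously_approximable_def by metis
  have "\<exists>w\<in>tf_span chi (int_lattice \<inter> square p (max r s)). norm (tf p (x + y) - w) \<le> e" for p
  proof -
    obtain u v where uv: "u \<in> tf_span chi (int_lattice \<inter> square p r)" "norm (tf p x - u) \<le> e / 2"
      "v \<in> tf_span chi (int_lattice \<inter> square p s)" "norm (tf p y - v) \<le> e / 2"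
      using r s by metis
    have "tf_span chi (int_lattice \<inter> square p r) \<subseteq> tf_span chi (int_lattice \<inter> square p (max r s))"
      "tf_span chi (int_lattice \<inter> square p s) \<subseteq> tf_span chi (int_lattice \<inter> square p (max r s))"
      by (intro tf_span_mono Int_mono order_refl square_mono max.cobounded1 max.cobounded2)+
    then have "u + v \<in> tf_span chi (int_lattice \<inter> square p (max r s))"
      using uv by (auto intro: subspace_add[OF subspace_tf_span])
    moreover have "norm (tf p (x + y) - (u + v)) \<le> e"
      using uv norm_triangle_ineq[of "tf p x - u" "tf p y - v"]
      by (simp add: linear_add[OF linear_tf] add_diff_add)
    ultimately show ?thesis by blast
  qed
  then show "\<exists>r. \<forall>p. \<exists>w\<in>tf_span chi (int_lattice \<inter> square p r). norm (tf p (x + y) - w) \<le> e"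
    by blast
qed

lemma homogeneously_approximable_scaleR:
  assumes "homogeneously_approximable x"
  shows "homogeneously_approximable (c *\<^sub>R x)"
proof -
  have "tf (0, 0) u = u" for u
    by transfer (auto simp: tf_shift_def)
  then show ?thesis
    using homogeneously_approximable_shift[OF assms, of "of_real c" "(0, 0)"]
      cscale_conv_scaleR[of "of_real c" x] by simp
qed

text \<open>Shifts are isometries, so the error made by replacing \<open>x\<close> with a nearby
  \<open>s\<close> is the same for every \<open>p\<close>.\<close>

lemma homogeneously_approximable_closure:
  assumes S: "\<And>s. s \<in> S \<Longrightarrow> homogeneously_approximable s" and x: "x \<in> closure S"
  shows "homogeneously_approximable x"
  unfolding homogeneously_approximable_def
proof (intro allI impI)
  fix e :: real assume "e > 0"
  then have e: "e / 2 > 0" by simp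
  then obtain s where s: "s \<in> S" "dist s x < e / 2"
    using x unfolding closure_approachable by blast
  obtain r where r: "\<And>p. \<exists>y\<in>tf_span chi (int_lattice \<inter> square p r). norm (tf p s - y) \<le> e / 2"
    using S[OF s(1)] e unfolding homogeneously_approximable_def by blast
  have "\<exists>y\<in>tf_span chi (int_lattice \<inter> square p r). norm (tf p x - y) \<le> e" for p
  proof -
    obtain y where y: "y \<in> tf_span chi (int_lattice \<inter> square p r)" "norm (tf p s - y) \<le> e / 2"
      using r by blast
    have "norm (tf p x - y) \<le> norm (tf p x - tf p s) + norm (tf p s - y)"
      by (rule norm_diff_triangle_le[OF order_refl order_refl])
    also have "norm (tf p x - tf p s) < e / 2"
      using s(2) by (simp add: linear_diff[OF linear_tf, symmetric] norm_tf dist_norm norm_minus_commute)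
    finally show ?thesis
      using y by (intro bexI[of _ y]) auto
  qed
  then show "\<exists>r. \<forall>p. \<exists>y\<in>tf_span chi (int_lattice \<inter> square p r). norm (tf p x - y) \<le> e"
    by blast
qed

text \<open>The approximable vectors form a closed subspace containing all lattice shifts of
  \<open>chi\<close>, and these span a dense subspace.\<close>

lemma homogeneously_approximable_all: "homogeneously_approximable x"
proof (rule homogeneously_approximable_closure)
  show "x \<in> closure (tf_span chi int_lattice)"
    using tf_span_chi_dense by simp
  fix s assume "s \<in> tf_span chi int_lattice"
  then have "s \<in> {s. homogeneously_approximable s}"
    unfolding tf_span_def
  proof (rule span_induct_subspace)
    have "homogeneously_approximable 0"
      using homogeneously_approximable_scaleR[OF homogeneously_approximable_chi, of 0] by simp
    then show "subspace {s. homogeneously_approximable s}"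
      by (simp add: subspace_def homogeneously_approximable_add homogeneously_approximable_scaleR)
  qed (auto intro: homogeneously_approximable_shift homogeneously_approximable_chi)
  then show "homogeneously_approximable s" by simp
qed

subsection \<open>Counting points\<close>

lemma L2_dist_span_le:
  assumes "u \<in> lin_span f I"
  shows "L2_dist_span h f I \<le> L2_norm (\<lambda>t. h t - u t)"
  unfolding L2_dist_span_def
  by (rule cINF_lower[OF _ assms]) (auto intro!: bdd_belowI[of _ 0] simp: L2_norm_def)

text \<open>Carries uniform minimality over to \<open>l2\<close>: an element of
  \<open>tf_span\<close> over a finite set is the class of a complex combination that competes in
  the infimum defining \<open>L2_dist_span\<close>.\<close>

lemma tf_separated:
  assumes g: "in_L2 g" and F: "finite F" "F \<subseteq> L" and p: "p \<in> L" "p \<notin> F"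
    and min: "\<And>n. n \<in> L \<Longrightarrow> L2_dist_span (tf_shift g n) (tf_shift g) (L - {n}) > d"
    and s: "s \<in> tf_span (abs_l2 g) F"
  shows "d \<le> norm (tf p (abs_l2 g) - s)"
proof -
  obtain c where "s = (\<Sum>q\<in>F. cscale (c q) (tf q (abs_l2 g)))"
    using tf_span_finite_sum[OF F(1) s] by blast
  also have "\<dots> = (\<Sum>q\<in>F. abs_l2 (\<lambda>t. c q * tf_shift g q t))"
    using g by (simp add: abs_l2_tf abs_l2_cscale in_L2_tf_shift)
  also have "\<dots> = abs_l2 (\<lambda>t. \<Sum>q\<in>F. c q * tf_shift g q t)"
    using F(1) g by (intro abs_l2_sum in_L2_mult in_L2_tf_shift) auto
  finally have s_eq: "s = abs_l2 (\<lambda>t. \<Sum>q\<in>F. c q * tf_shift g q t)" .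
  have "(\<lambda>t. \<Sum>q\<in>F. c q * tf_shift g q t) \<in> lin_span (tf_shift g) (L - {p})"
    unfolding lin_span_def using F p by blast
  then have "d < L2_norm (\<lambda>t. tf_shift g p t - (\<Sum>q\<in>F. c q * tf_shift g q t))"
    by (rule less_le_trans[OF min[OF p(1)] L2_dist_span_le])
  also have "\<dots> = norm (tf p (abs_l2 g) - s)"
    unfolding s_eq using g
    by (simp add: abs_l2_tf abs_l2_diff norm_abs_l2 in_L2_diff in_L2_sum in_L2_mult in_L2_tf_shift)
  finally show ?thesis by simp
qed

text \<open>
  Passing from complex to real coefficients costs nothing in the separation constant: a real
  multiple of \<open>\<i> x\<close> can be absorbed into \<open>x\<close>, whose coefficient then has modulus at
  least 1.
\<close>
lemma real_separated:
  assumes z: "z = 1 \<or> z = \<i>"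
    and sep: "\<And>s. s \<in> tf_span x (F - {p}) \<Longrightarrow> d \<le> norm (tf p x - s)"
    and u: "u \<in> span ((\<lambda>(p, z). cscale z (tf p x)) ` (F \<times> {1, \<i>} - {(p, z)}))"
  shows "d \<le> norm (cscale z (tf p x) - u)"
proof -
  \<comment> \<open>After multiplication by \<open>inverse z\<close> the omitted generator becomes
    \<open>tf p x\<close>, and the other generator at \<open>p\<close> becomes plus or minus
    \<open>cscale \<i> (tf p x)\<close>. So \<open>V\<close> contains the image of every remaining
    generator.\<close>
  define V where "V = {y. \<exists>s r. s \<in> tf_span x (F - {p}) \<and> y = s + r *\<^sub>R cscale \<i> (tf p x)}"
  have V: "subspace V"
    unfolding subspace_def
  proof (intro conjI allI ballI)
    show "0 \<in> V"
      unfolding V_def using subspace_0[OF subspace_tf_span]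
      by (auto intro!: exI[of _ "0::l2"] exI[of _ "0::real"])
  next
    fix a b assume "a \<in> V" "b \<in> V"
    then obtain s r s' r' where "s \<in> tf_span x (F - {p})" "a = s + r *\<^sub>R cscale \<i> (tf p x)"
      "s' \<in> tf_span x (F - {p})" "b = s' + r' *\<^sub>R cscale \<i> (tf p x)"
      unfolding V_def by blast
    then show "a + b \<in> V"
      unfolding V_def using subspace_add[OF subspace_tf_span]
      by (auto simp: algebra_simps intro!: exI[of _ "s + s'"] exI[of _ "r + r'"])
  next
    fix c a assume "a \<in> V"
    then obtain s r where "s \<in> tf_span x (F - {p})" "a = s + r *\<^sub>R cscale \<i> (tf p x)"
      unfolding V_def by blast
    then show "c *\<^sub>R a \<in> V"
      unfolding V_def using subspace_scale[OF subspace_tf_span]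
      by (auto simp: algebra_simps intro!: exI[of _ "c *\<^sub>R s"] exI[of _ "c * r"])
  qed
  have gen: "cscale (inverse z) y \<in> V"
    if "y \<in> (\<lambda>(p, z). cscale z (tf p x)) ` (F \<times> {1, \<i>} - {(p, z)})" for y
  proof -
    from that obtain q w where qw: "y = cscale w (tf q x)" "q \<in> F" "w = 1 \<or> w = \<i>"
      "q \<noteq> p \<or> w \<noteq> z"
      by auto
    show ?thesis
    proof (cases "q = p")
      case True
      then have "cscale (inverse z) y = 0 + (if z = 1 then 1 else -1) *\<^sub>R cscale \<i> (tf p x)"
        using qw z cscale_conv_scaleR[of "-\<i>" "tf p x"] by (auto simp: cscale_cscale)
      then show ?thesis
        unfolding V_def using subspace_0[OF subspace_tf_span] by blast
    next
      case False
      then have "cscale (inverse z) y \<in> tf_span x (F - {p})"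
        using qw by (auto simp: cscale_cscale intro!: cscale_tf_in_tf_span)
      then show ?thesis
        unfolding V_def by (auto intro!: exI[of _ "cscale (inverse z) y"] exI[of _ "0::real"])
    qed
  qed
  have "u \<in> cscale (inverse z) -` V"
    using gen by (intro span_induct_subspace[OF u linear_subspace_vimage[OF linear_cscale V]]) auto
  then obtain s r where s: "s \<in> tf_span x (F - {p})"
    and r: "cscale (inverse z) u = s + r *\<^sub>R cscale \<i> (tf p x)"
    unfolding V_def by auto
  \<comment> \<open>Collecting the multiples of \<open>tf p x\<close> gives the factor
    \<open>1 - \<i> r\<close>, whose real part 1 forces modulus at least 1.\<close>
  define c where "c = Complex 1 (- r)"
  have c0: "c \<noteq> 0" and c1: "1 \<le> cmod c"
    using complex_Re_le_cmod[of c] by (auto simp: c_def complex_eq_iff)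
  have z1: "z \<noteq> 0" "cmod (inverse z) = 1"
    using z by auto
  have "tf p x - cscale (inverse z) u = cscale c (tf p x) - s"
    using cscale_conv_scaleR[of c "tf p x"] by (simp add: r c_def)
  also have "\<dots> = cscale c (tf p x - cscale (inverse c) s)"
    using c0 by (simp add: linear_diff[OF linear_cscale] cscale_cscale cscale_one)
  finally have eq: "norm (tf p x - cscale (inverse z) u) = cmod c * norm (tf p x - cscale (inverse c) s)"
    by (simp add: norm_cscale)
  have "d \<le> 1 * norm (tf p x - cscale (inverse c) s)"
    using sep[OF cscale_tf_span[OF s]] by simp
  also have "\<dots> \<le> cmod c * norm (tf p x - cscale (inverse c) s)"
    using c1 by (intro mult_right_mono) auto
  also have "\<dots> = norm (cscale (inverse z) (cscale z (tf p x) - u))"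
    using z1 by (simp add: eq[symmetric] linear_diff[OF linear_cscale] cscale_cscale cscale_one)
  also have "\<dots> = norm (cscale z (tf p x) - u)"
    using z1 by (simp add: norm_cscale)
  finally show ?thesis .
qed

section \<open>Lattice points in squares and the comparison of cardinalities\<close>

lemma card_int_interval:
  assumes "s \<ge> 0"
  shows "finite (\<int> \<inter> {x::real. \<bar>x - a\<bar> \<le> s})" "real (card (\<int> \<inter> {x::real. \<bar>x - a\<bar> \<le> s})) \<le> 2 * s + 1"
proof -
  have eq: "\<int> \<inter> {x::real. \<bar>x - a\<bar> \<le> s} = of_int ` {\<lceil>a - s\<rceil>..\<lfloor>a + s\<rfloor>}"
    by (auto simp: Ints_def image_def ceiling_le_iff le_floor_iff abs_le_iff algebra_simps)
  then show "finite (\<int> \<inter> {x::real. \<bar>x - a\<bar> \<le> s})"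
    by simp
  define n where "n = \<lfloor>a + s\<rfloor> - \<lceil>a - s\<rceil> + 1"
  have "card (\<int> \<inter> {x::real. \<bar>x - a\<bar> \<le> s}) = nat n"
    unfolding eq n_def by (subst card_image) (auto simp: inj_on_def)
  moreover have "real_of_int n \<le> 2 * s + 1"
    using of_int_floor_le[of "a + s"] le_of_int_ceiling[of "a - s"] unfolding n_def by linarith
  then have "real (nat n) \<le> 2 * s + 1"
    using assms by (cases "n \<ge> 0") auto
  ultimately show "real (card (\<int> \<inter> {x::real. \<bar>x - a\<bar> \<le> s})) \<le> 2 * s + 1"
    by simp
qed

lemma card_int_lattice_square:
  assumes "s \<ge> 0"
  shows "finite (int_lattice \<inter> square c s)" "real (card (int_lattice \<inter> square c s)) \<le> (2 * s + 1)\<^sup>2"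
proof -
  have eq: "int_lattice \<inter> square c s =
      (\<int> \<inter> {x. \<bar>x - fst c\<bar> \<le> s}) \<times> (\<int> \<inter> {x. \<bar>x - snd c\<bar> \<le> s})"
    by (auto simp: square_def)
  show "finite (int_lattice \<inter> square c s)"
    unfolding eq using card_int_interval[OF assms] by auto
  show "real (card (int_lattice \<inter> square c s)) \<le> (2 * s + 1)\<^sup>2"
    unfolding eq card_cartesian_product power2_eq_square of_nat_mult
    using card_int_interval[OF assms] assms by (intro mult_mono) auto
qed

text \<open>The trace estimate is applied to real spans, so both systems are doubled by the factors
  1 and \<open>\<i>\<close>; the two factors of 2 cancel.\<close>

lemma card_le_of_uniformly_minimal:
  assumes g: "in_L2 g" and d: "d > 0"
    and min: "\<And>n. n \<in> L \<Longrightarrow> L2_dist_span (tf_shift g n) (tf_shift g) (L - {n}) > d"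
    and near: "\<And>p. \<exists>y\<in>tf_span chi (int_lattice \<inter> square p r). norm (tf p (abs_l2 g) - y) \<le> e"
    and F: "finite F" "F \<subseteq> L \<inter> square c R" and Rr: "R + r \<ge> 0"
  shows "real (card F) * (1 - e / d) \<le> (2 * (R + r) + 1)\<^sup>2"
proof -
  define v where "v = (\<lambda>(p, z). cscale z (tf p (abs_l2 g)))"
  define P where "P = int_lattice \<inter> square c (R + r)"
  define B where "B = (\<lambda>(p, z). cscale z (tf p chi)) ` (P \<times> {1, \<i>})"
  have P: "finite P" "real (card P) \<le> (2 * (R + r) + 1)\<^sup>2"
    unfolding P_def using card_int_lattice_square[OF Rr] by auto
  have "real (card (F \<times> {1, \<i>})) * (1 - e / d) \<le> real (card B)"
  proof (rule card_le_of_near_subspace[where v = v])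
    show "finite (F \<times> {1, \<i>})" "finite B"
      using F(1) P(1) by (auto simp: B_def)
    fix i assume "i \<in> F \<times> {1, \<i>}"
    then obtain p z where i: "i = (p, z)" "p \<in> F" "z = 1 \<or> z = \<i>"
      by auto
    show "d \<le> norm (v i - u)" if "u \<in> span (v ` (F \<times> {1, \<i>} - {i}))" for u
    proof -
      have "d \<le> norm (tf p (abs_l2 g) - s)" if "s \<in> tf_span (abs_l2 g) (F - {p})" for s
        using tf_separated[OF g _ _ _ _ min that] F i(2) by blast
      from real_separated[OF i(3) this] that show ?thesis
        by (simp add: v_def i(1))
    qed
    show "\<exists>w\<in>span B. norm (v i - w) \<le> e"
    proof -
      obtain y where y: "y \<in> tf_span chi (int_lattice \<inter> square p r)"
        "norm (tf p (abs_l2 g) - y) \<le> e"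
        using near by blast
      \<comment> \<open>As \<open>p\<close> lies in the square of radius \<open>R\<close>, one
        lattice set \<open>P\<close> serves all points of \<open>F\<close> at once.\<close>
      have "square p r \<subseteq> square c (R + r)"
        using F(2) i(2) by (fastforce simp: square_def)
      then have "y \<in> tf_span chi P"
        using y(1) tf_span_mono[of "int_lattice \<inter> square p r" P chi] by (auto simp: P_def)
      then have "cscale z y \<in> span B"
        using cscale_tf_span[of y chi P z] by (simp add: tf_span_def B_def)
      moreover have "norm (v i - cscale z y) \<le> e"
        using y(2) i by (auto simp: v_def linear_diff[OF linear_cscale, symmetric] norm_cscale)
      ultimately show ?thesis by blast
    qed
  qed (rule d)
  also have "card B \<le> card (P \<times> {1, \<i>})"
    unfolding B_def using P(1) by (intro card_image_le) auto
  also have "card (P \<times> {1, \<i>}) = 2 * card P"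
    by (simp add: card_cartesian_product)
  finally show ?thesis
    using P(2) by (simp add: card_cartesian_product)
qed

text \<open>An infinite intersection would contain finite subsets of every size, so a bound on
  finite subsets excludes the value \<infinity>.\<close>

lemma num_pts_le:
  assumes "\<And>F. finite F \<Longrightarrow> F \<subseteq> L \<inter> S \<Longrightarrow> real (card F) \<le> b"
  shows "num_pts L S \<le> ereal b"
proof (cases "finite (L \<inter> S)")
  case True
  then show ?thesis
    using assms[OF True] by (simp add: num_pts_def)
next
  case False
  obtain m :: nat where m: "b < real m"
    using reals_Archimedean2 by blast
  obtain F where F: "finite F" "card F = m" "F \<subseteq> L \<inter> S"
    using infinite_arbitrarily_large[OF False] by blast
  show ?thesis
    using assms[OF F(1,3)] F(2) m by simp
qed

theorem theorem2:
  fixes g :: "real \<Rightarrow> complex" and \<Lambda> :: "(real \<times> real) set"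
  assumes "in_L2 g"
    and "uniformly_minimal (tf_shift g) \<Lambda>"
  shows "upper_density \<Lambda> \<le> 1"
proof -
  obtain d where d: "d > 0"
    and min: "\<And>n. n \<in> \<Lambda> \<Longrightarrow> L2_dist_span (tf_shift g n) (tf_shift g) (\<Lambda> - {n}) > d"
    using assms(2) by (auto simp: uniformly_minimal_def)
  have "upper_density \<Lambda> \<le> 1 + ereal \<eta>" if \<eta>: "\<eta> > 0" for \<eta> :: real
  proof -
    \<comment> \<open>Chosen so that the factor \<open>1 - e / d\<close> of the counting bound is
      exactly \<open>1 / (1 + \<eta>)\<close>.\<close>
    define e where "e = d * \<eta> / (1 + \<eta>)"
    have "e / d = \<eta> / (1 + \<eta>)"
      using d by (simp add: e_def)
    then have e: "e > 0" "1 - e / d = 1 / (1 + \<eta>)"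
      using d \<eta> by (simp_all add: e_def diff_divide_eq_iff)
    obtain r where r: "\<And>p. \<exists>y\<in>tf_span chi (int_lattice \<inter> square p r). norm (tf p (abs_l2 g) - y) \<le> e"
      using homogeneously_approximable_all[of "abs_l2 g"] e(1)
      unfolding homogeneously_approximable_def by blast
    define b where "b R = (1 + \<eta>) * (2 * (R + r) + 1)\<^sup>2" for R
    have le: "(SUP c. num_pts \<Lambda> (square c R)) / ereal ((2 * R)\<^sup>2) \<le> ereal (b R / (2 * R)\<^sup>2)"
      if R: "R > 0" "R + r \<ge> 0" for R
    proof -
      have "num_pts \<Lambda> (square c R) \<le> ereal (b R)" for c
      proof (rule num_pts_le)
        fix F assume "finite F" "F \<subseteq> \<Lambda> \<inter> square c R"
        from card_le_of_uniformly_minimal[OF assms(1) d min r this R(2)]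
        show "real (card F) \<le> b R"
          unfolding e(2) b_def using \<eta> by (simp add: pos_divide_le_eq mult.commute)
      qed
      then have "(SUP c. num_pts \<Lambda> (square c R)) \<le> ereal (b R)"
        by (rule SUP_least)
      then have "(SUP c. num_pts \<Lambda> (square c R)) / ereal ((2 * R)\<^sup>2) \<le> ereal (b R) / ereal ((2 * R)\<^sup>2)"
        using R(1) by (intro ereal_divide_right_mono) auto
      then show ?thesis
        using R(1) by simp
    qed
    have "\<forall>\<^sub>F R in at_top. (SUP c. num_pts \<Lambda> (square c R)) / ereal ((2 * R)\<^sup>2) \<le> ereal (b R / (2 * R)\<^sup>2)"
      using eventually_gt_at_top[of 0] eventually_ge_at_top[of "- r"]
      by eventually_elim (rule le, simp_all)
    then have "upper_density \<Lambda> \<le> Limsup at_top (\<lambda>R. ereal (b R / (2 * R)\<^sup>2))"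
      unfolding upper_density_def by (rule Limsup_mono)
    also have "\<dots> = ereal (1 + \<eta>)"
    proof (rule lim_imp_Limsup)
      \<comment> \<open>This is \<open>b R\<close> divided by the squared side length
        \<open>2 * R\<close>, rewritten to show the limit; the enlargement by \<open>r\<close> and
        by 1 disappears as \<open>R\<close> grows.\<close>
      have lim: "((\<lambda>R. (1 + \<eta>) * (1 + (2 * r + 1) / 2 * inverse R)\<^sup>2) \<longlongrightarrow> (1 + \<eta>) * (1 + (2 * r + 1) / 2 * 0)\<^sup>2) at_top"
        by (intro tendsto_intros tendsto_inverse_0_at_top filterlim_ident)
      have "\<forall>\<^sub>F R in at_top. (1 + \<eta>) * (1 + (2 * r + 1) / 2 * inverse R)\<^sup>2 = b R / (2 * R)\<^sup>2"
        using eventually_gt_at_top[of 0]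
      proof eventually_elim
        case (elim R)
        then have "1 + (2 * r + 1) / 2 * inverse R = (2 * (R + r) + 1) / (2 * R)"
          by (simp add: field_simps)
        then show ?case
          by (simp add: b_def power_divide)
      qed
      from Lim_transform_eventually[OF lim this] show "((\<lambda>R. ereal (b R / (2 * R)\<^sup>2)) \<longlongrightarrow> ereal (1 + \<eta>)) at_top"
        by simp
    qed simp
    finally show ?thesis
      by (simp only: plus_ereal.simps(1) one_ereal_def)
  qed
  then show ?thesis
    by (rule ereal_le_epsilon2) auto
qed

end
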